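(* Let $\kappa\in\mathbb{Z}_p\setminus\mathbb{Z}_{\geq0}$. Then $H^0_\kappa(\mathcal{S}(b',\varepsilon)) := \ker(\widehat\partial_\kappa\mid\mathcal{S}(b',\varepsilon)) = 0$ and $H^1_\kappa(\mathcal{S}(b',\varepsilon)) := \mathcal{S}(b',\varepsilon)/\widehat\partial_\kappa\mathcal{S}(b',\varepsilon)\cong\mathcal{R}(b')$. Furthermore, \[ \mathcal{S}(b',\varepsilon;0) = \mathcal{R}(b';0)\oplus\widehat\partial_\kappa\,\mathcal{S}(b',\varepsilon;\varepsilon). \]
   Context: Fix a prime $p\geq5$. Let $\gamma\in\overline{\mathbb{Q}}_p$ be a root of $\sum_{i\geq0}t^{p^i}/p^i$ with $\mathrm{ord}_p\gamma=1/(p-1)$, $\Omega_0 := \mathbb{Q}_p(\gamma)$, $\gamma_l := \sum_{i=0}^l\gamma^{p^i}/p^i$, $\hat b := p/(p-1)$. Let $b,b'$ be reals with $\hat b\geq b>1/(p-1)$, $b\geq b'$, and $\varepsilon := b-1/(p-1)$. Spaces over $\Omega_0$: $\mathcal{L}(b';\rho) := \{\sum_{n\geq0}A(n)t^n : A(n)\in\Omega_0,\ \mathrm{ord}_pA(n)\geq2b'n+\rho\}$, $\mathcal{L}(b') := \bigcup_\rho\mathcal{L}(b';\rho)$; $\mathcal{K}(b',b;\rho)$ is the set of $\sum_{n\geq0,u\in\mathbb{Z}}A(n,u)t^nt^{m(u)}x^u$ ($m(u):=\max\{-u,0\}$) with $\mathrm{ord}_pA(n,u)\geq2b'n+b|u|+\rho$,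 $\mathcal{K}(b',b):=\bigcup_\rho\mathcal{K}(b',b;\rho)$; $\mathcal{V}(b',b) := (\Omega_0[[t]]+\Omega_0[[t]]\,t/x)\cap\mathcal{K}(b',b)$. Operators: with $f(t,x) := x+t/x$ and $f_x := x\partial f/\partial x$, put $W_1 := \sum_{j\geq0}\gamma_jp^jf_x(t^{p^j},x^{p^j})$, $W_2 := \sum_{j\geq0}\gamma_jp^j(t/x)^{p^j}$, $\widehat D_t := x\partial/\partial x+W_1$, $\widehat\partial := t\partial/\partial t+W_2$ on $\mathcal{K}(b',b)$; they commute. It is known that $\mathcal{K}(b',b;0)=\mathcal{V}(b',b;0)\oplus\widehat D_t\mathcal{K}(b',b;\varepsilon)$, so $\mathcal{K}(b',b)/\widehat D_t\mathcal{K}(b',b)$ is a free $\mathcal{L}(b')$-module with basis $\{1,\gamma t/x\}$. Define $\widehat H=(\widehat H_{ij})_{i,j\in\{0,1\}}$ over $\mathcal{L}(b')$ by $\widehat\partial(1)\equiv\widehat H_{00}+\widehat H_{01}\gamma t/x$, $\widehat\partial(\gamma t/x)\equiv\widehat H_{10}+\widehat H_{11}\gamma t/x$ modulo $\widehat D_t\mathcal{K}(b',b)$. Symmetric powers: $\kappa^{\underline m} := \kappa(\kappa-1)\cdots(\kappa-m+1)$, $w^{(m)} := \kappa^{\underline m}w^m$ in $\Omega_0[[t,w]]$; $\mathcal{S}(b',\varepsilon;\rho)$ is the set of $\sum_{n,m\geq0}A(n,m)t^nw^{(m)}$ with $A(n,m)\in\Omega_0$, $\mathrm{ord}_pA(n,m)\geq2b'n+\varepsilon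 m+\rho$, $\mathcal{S}(b',\varepsilon):=\bigcup_\rho\mathcal{S}(b',\varepsilon;\rho)$; $\mathcal{R}(b';\rho)\subset\mathcal{S}(b',\varepsilon;\rho)$ is the subset of series $\sum_nA(n)t^n$ involving only $w^{(0)}=1$, $\mathcal{R}(b'):=\bigcup_\rho\mathcal{R}(b';\rho)$. $\mathcal{L}_{\kappa,\widehat H}$ is the $\Omega_0[[t]]$-linear, termwise-extended map $\mathcal{L}_{\kappa,\widehat H}(w^{(m)}) := (\kappa-m)\widehat H_{00}w^{(m)}+\widehat H_{01}w^{(m+1)}+m(\kappa-m+1)\widehat H_{10}w^{(m-1)}+m\widehat H_{11}w^{(m)}$, and $\widehat\partial_\kappa := t\frac{d}{dt}+\mathcal{L}_{\kappa,\widehat H}$ on $\mathcal{S}(b',\varepsilon)$, where $t\frac{d}{dt}(\sum A(n,m)t^nw^{(m)}) := \sum nA(n,m)t^nw^{(m)}$. *)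

theory Defs
  imports
    "HOL-Library.Extended_Real"
    "HOL-Library.Groups_Big_Fun"
    "HOL-Library.Set_Algebras"
    "HOL-Computational_Algebra.Computational_Algebra"
begin

section \<open>The fields \<open>\<rat>\<^sub>p\<close>, its algebraic closure, and \<open>\<Omega>\<^sub>0\<close>\<close>

text \<open>\<open>\<rat>\<^sub>p\<close> as the closure of the prime field in the ambient valued field.\<close>

definition Qp :: "('a::field_char_0 \<Rightarrow> ereal) \<Rightarrow> 'a set" where
  "Qp ordp = {x. \<forall>M::real. \<exists>q::rat. ordp (x - of_rat q) \<ge> ereal M}"

definition Zp :: "('a::field_char_0 \<Rightarrow> ereal) \<Rightarrow> 'a set" where
  "Zp ordp = {x \<in> Qp ordp. ordp x \<ge> 0}"

text \<open>
  The type \<open>'a\<close> together with \<open>ordp\<close> is an algebraic closure of \<open>\<rat>\<^sub>p\<close> with its \<open>p\<close>-adic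
  valuation: \<open>ordp\<close> is a valuation with \<open>ordp p = 1\<close> (so that it restricts to the \<open>p\<close>-adic
  valuation on the rationals), the closure of the rationals is complete and hence is the
  completion \<open>\<rat>\<^sub>p\<close>, and \<open>'a\<close> is algebraically closed and algebraic over it.  This determines
  the pair up to isomorphism.
\<close>

locale Qp_algebraic_closure =
  fixes p :: nat
    and ordp :: "'a::{alg_closed_field, field_char_0} \<Rightarrow> ereal"
  assumes prime_p: "prime p"
    and ordp_eq_PInf_iff: "ordp x = \<infinity> \<longleftrightarrow> x = 0"
    and ordp_not_MInf: "ordp x \<noteq> - \<infinity>"
    and ordp_mult: "ordp (x * y) = ordp x + ordp y"
    and ordp_add: "ordp (x + y) \<ge> min (ordp x) (ordp y)"
    and ordp_p: "ordp (of_nat p) = 1"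
    and Qp_complete:
      "(\<forall>M::real. \<exists>N. \<forall>i\<ge>N. \<forall>j\<ge>N. ordp (of_rat (s i) - of_rat (s j)) \<ge> ereal M) \<Longrightarrow>
       \<exists>x. (\<lambda>i. ordp (x - of_rat (s i))) \<longlonglongrightarrow> \<infinity>"
    and algebraic_over_Qp:
      "\<exists>q::'a poly. q \<noteq> 0 \<and> (\<forall>i. coeff q i \<in> Qp ordp) \<and> poly q x = 0"

definition is_subfield :: "'a::field set \<Rightarrow> bool" where
  "is_subfield F \<longleftrightarrow> 0 \<in> F \<and> 1 \<in> F \<and> (\<forall>x\<in>F. \<forall>y\<in>F. x + y \<in> F \<and> x * y \<in> F)
     \<and> (\<forall>x\<in>F. - x \<in> F \<and> inverse x \<in> F)"

definition Omega0 :: "('a::field_char_0 \<Rightarrow> ereal) \<Rightarrow> 'a \<Rightarrow> 'a set" where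
  "Omega0 ordp \<gamma> = \<Inter>{F. is_subfield F \<and> Qp ordp \<subseteq> F \<and> \<gamma> \<in> F}"

definition gamma_part :: "nat \<Rightarrow> 'a::field_char_0 \<Rightarrow> nat \<Rightarrow> 'a" where
  "gamma_part p \<gamma> l = (\<Sum>i\<le>l. \<gamma> ^ (p ^ i) / of_nat p ^ i)"

text \<open>\<open>\<gamma>\<close> is a root of \<open>\<Sum>\<^sub>i t^(p^i)/p^i\<close>: the partial sums at \<open>\<gamma>\<close> tend to \<open>0\<close>, i.e. their
  valuations tend to infinity.\<close>

definition is_splitting_root :: "nat \<Rightarrow> ('a::field_char_0 \<Rightarrow> ereal) \<Rightarrow> 'a \<Rightarrow> bool" where
  "is_splitting_root p ordp \<gamma> \<longleftrightarrow>
     (\<lambda>l. ordp (gamma_part p \<gamma> l)) \<longlonglongrightarrow> \<infinity> \<and> ordp \<gamma> = ereal (1 / (real p - 1))"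


section \<open>Power series in \<open>t\<close>\<close>

definition L_space_rho ::
    "('a::field_char_0 \<Rightarrow> ereal) \<Rightarrow> 'a \<Rightarrow> real \<Rightarrow> real \<Rightarrow> 'a fps set" where
  "L_space_rho ordp \<gamma> b' \<rho> =
     {F. \<forall>n. fps_nth F n \<in> Omega0 ordp \<gamma> \<and> ordp (fps_nth F n) \<ge> ereal (2 * b' * real n + \<rho>)}"

definition L_space :: "('a::field_char_0 \<Rightarrow> ereal) \<Rightarrow> 'a \<Rightarrow> real \<Rightarrow> 'a fps set" where
  "L_space ordp \<gamma> b' = (\<Union>\<rho>. L_space_rho ordp \<gamma> b' \<rho>)"


section \<open>Formal series in \<open>t, x, 1/x\<close>\<close>

text \<open>A formal series is given by its coefficients: \<open>F k u\<close> is the coefficient of \<open>t^k x^u\<close>.\<close>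

type_synonym 'a txseries = "nat \<Rightarrow> int \<Rightarrow> 'a"

definition tx_plus :: "'a::field txseries \<Rightarrow> 'a txseries \<Rightarrow> 'a txseries" (infixl \<open>\<oplus>\<^sub>t\<^sub>x\<close> 65) where
  "F \<oplus>\<^sub>t\<^sub>x G = (\<lambda>k u. F k u + G k u)"

definition tx_scale :: "'a::field \<Rightarrow> 'a txseries \<Rightarrow> 'a txseries" where
  "tx_scale c F = (\<lambda>k u. c * F k u)"

text \<open>\<open>Sum_any\<close> adds up the nonzero terms.  For series with \<open>F k u = 0\<close> unless \<open>k \<ge> -u\<close>, as in
  all uses below, only finitely many terms are nonzero.\<close>

definition tx_times :: "'a::field txseries \<Rightarrow> 'a txseries \<Rightarrow> 'a txseries" (infixl \<open>\<otimes>\<^sub>t\<^sub>x\<close> 70) where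
  "F \<otimes>\<^sub>t\<^sub>x G = (\<lambda>k u. \<Sum>i\<le>k. Sum_any (\<lambda>v. F i v * G (k - i) (u - v)))"

definition tx_monom :: "nat \<Rightarrow> int \<Rightarrow> 'a::field txseries" where
  "tx_monom i v = (\<lambda>k u. if k = i \<and> u = v then 1 else 0)"

definition tx_of_fps :: "'a::field fps \<Rightarrow> 'a txseries" where
  "tx_of_fps F = (\<lambda>k u. if u = 0 then fps_nth F k else 0)"

definition x_dx :: "'a::field txseries \<Rightarrow> 'a txseries" where
  "x_dx F = (\<lambda>k u. of_int u * F k u)"

definition t_dt :: "'a::field txseries \<Rightarrow> 'a txseries" where
  "t_dt F = (\<lambda>k u. of_nat k * F k u)"

text \<open>The substitution \<open>F(t^q, x^q)\<close>.\<close>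

definition tx_subst_power :: "nat \<Rightarrow> 'a::field txseries \<Rightarrow> 'a txseries" where
  "tx_subst_power q F =
     (\<lambda>k u. if q dvd k \<and> int q dvd u then F (k div q) (u div int q) else 0)"

definition m_exp :: "int \<Rightarrow> nat" where
  "m_exp u = nat (max (- u) 0)"

text \<open>\<open>\<Sum> A(n,u) t^n t^(m(u)) x^u\<close>\<close>

definition K_series :: "(nat \<Rightarrow> int \<Rightarrow> 'a::field) \<Rightarrow> 'a txseries" where
  "K_series A = (\<lambda>k u. if m_exp u \<le> k then A (k - m_exp u) u else 0)"

definition K_space_rho ::
    "('a::field_char_0 \<Rightarrow> ereal) \<Rightarrow> 'a \<Rightarrow> real \<Rightarrow> real \<Rightarrow> real \<Rightarrow> 'a txseries set" where
  "K_space_rho ordp \<gamma> b' b \<rho> =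
     {K_series A |A. \<forall>n u. A n u \<in> Omega0 ordp \<gamma> \<and>
        ordp (A n u) \<ge> ereal (2 * b' * real n + b * \<bar>real_of_int u\<bar> + \<rho>)}"

definition K_space ::
    "('a::field_char_0 \<Rightarrow> ereal) \<Rightarrow> 'a \<Rightarrow> real \<Rightarrow> real \<Rightarrow> 'a txseries set" where
  "K_space ordp \<gamma> b' b = (\<Union>\<rho>. K_space_rho ordp \<gamma> b' b \<rho>)"

definition f_tx :: "'a::field txseries" where
  "f_tx = tx_monom 0 1 \<oplus>\<^sub>t\<^sub>x tx_monom 1 (- 1)"

definition W1 :: "nat \<Rightarrow> 'a::field_char_0 \<Rightarrow> 'a txseries" where
  "W1 p \<gamma> = (\<lambda>k u. Sum_any (\<lambda>j.
     gamma_part p \<gamma> j * of_nat p ^ j * tx_subst_power (p ^ j) (x_dx f_tx) k u))"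

definition W2 :: "nat \<Rightarrow> 'a::field_char_0 \<Rightarrow> 'a txseries" where
  "W2 p \<gamma> = (\<lambda>k u. Sum_any (\<lambda>j.
     gamma_part p \<gamma> j * of_nat p ^ j * tx_monom (p ^ j) (- int (p ^ j)) k u))"

definition D_hat :: "nat \<Rightarrow> 'a::field_char_0 \<Rightarrow> 'a txseries \<Rightarrow> 'a txseries" where
  "D_hat p \<gamma> F = x_dx F \<oplus>\<^sub>t\<^sub>x (W1 p \<gamma> \<otimes>\<^sub>t\<^sub>x F)"

definition del_hat :: "nat \<Rightarrow> 'a::field_char_0 \<Rightarrow> 'a txseries \<Rightarrow> 'a txseries" where
  "del_hat p \<gamma> F = t_dt F \<oplus>\<^sub>t\<^sub>x (W2 p \<gamma> \<otimes>\<^sub>t\<^sub>x F)"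

definition cong_mod_D_hat ::
    "nat \<Rightarrow> ('a::field_char_0 \<Rightarrow> ereal) \<Rightarrow> 'a \<Rightarrow> real \<Rightarrow> real \<Rightarrow> 'a txseries \<Rightarrow> 'a txseries \<Rightarrow> bool"
  where
  "cong_mod_D_hat p ordp \<gamma> b' b F G \<longleftrightarrow>
     (\<exists>\<xi>\<in>K_space ordp \<gamma> b' b. F = G \<oplus>\<^sub>t\<^sub>x D_hat p \<gamma> \<xi>)"

text \<open>The basis element \<open>\<gamma>t/x\<close>.\<close>

definition gamma_t_over_x :: "'a::field \<Rightarrow> 'a txseries" where
  "gamma_t_over_x \<gamma> = tx_scale \<gamma> (tx_monom 1 (- 1))"

text \<open>\<open>H\<close>, indexed by \<open>{0, 1}\<close>, is the matrix of \<open>del_hat\<close> modulo the image of \<open>D_hat\<close> with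
  respect to the basis \<open>1, \<gamma>t/x\<close>.\<close>

definition is_H_hat ::
    "nat \<Rightarrow> ('a::field_char_0 \<Rightarrow> ereal) \<Rightarrow> 'a \<Rightarrow> real \<Rightarrow> real \<Rightarrow> (nat \<Rightarrow> nat \<Rightarrow> 'a fps) \<Rightarrow> bool" where
  "is_H_hat p ordp \<gamma> b' b H \<longleftrightarrow>
     (\<forall>i\<in>{0, 1}. \<forall>j\<in>{0, 1}. H i j \<in> L_space ordp \<gamma> b') \<and>
     cong_mod_D_hat p ordp \<gamma> b' b (del_hat p \<gamma> (tx_monom 0 0))
       (tx_of_fps (H 0 0) \<oplus>\<^sub>t\<^sub>x tx_of_fps (H 0 1) \<otimes>\<^sub>t\<^sub>x gamma_t_over_x \<gamma>) \<and>
     cong_mod_D_hat p ordp \<gamma> b' b (del_hat p \<gamma> (gamma_t_over_x \<gamma>))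
       (tx_of_fps (H 1 0) \<oplus>\<^sub>t\<^sub>x tx_of_fps (H 1 1) \<otimes>\<^sub>t\<^sub>x gamma_t_over_x \<gamma>)"


section \<open>Symmetric powers\<close>

text \<open>Series in \<open>t, w\<close> are elements of \<open>'a fps fps\<close>: the outer variable is \<open>w\<close>, the inner one
  is \<open>t\<close>.\<close>

definition falling :: "'a::field \<Rightarrow> nat \<Rightarrow> 'a" where
  "falling \<kappa> m = (\<Prod>i<m. \<kappa> - of_nat i)"

text \<open>\<open>w^(m)\<close>\<close>

definition w_div :: "'a::field \<Rightarrow> nat \<Rightarrow> 'a fps fps" where
  "w_div \<kappa> m = fps_const (fps_const (falling \<kappa> m)) * fps_X ^ m"

text \<open>\<open>\<Sum> A(n,m) t^n w^(m)\<close>, written out by its coefficients.\<close>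

definition S_series :: "'a::field \<Rightarrow> (nat \<Rightarrow> nat \<Rightarrow> 'a) \<Rightarrow> 'a fps fps" where
  "S_series \<kappa> A = Abs_fps (\<lambda>m. Abs_fps (\<lambda>n. A n m) * fps_const (falling \<kappa> m))"

definition S_space_rho ::
    "('a::field_char_0 \<Rightarrow> ereal) \<Rightarrow> 'a \<Rightarrow> 'a \<Rightarrow> real \<Rightarrow> real \<Rightarrow> real \<Rightarrow> 'a fps fps set" where
  "S_space_rho ordp \<gamma> \<kappa> b' \<epsilon> \<rho> =
     {S_series \<kappa> A |A. \<forall>n m. A n m \<in> Omega0 ordp \<gamma> \<and>
        ordp (A n m) \<ge> ereal (2 * b' * real n + \<epsilon> * real m + \<rho>)}"

definition S_space ::
    "('a::field_char_0 \<Rightarrow> ereal) \<Rightarrow> 'a \<Rightarrow> 'a \<Rightarrow> real \<Rightarrow> real \<Rightarrow> 'a fps fps set" where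
  "S_space ordp \<gamma> \<kappa> b' \<epsilon> = (\<Union>\<rho>. S_space_rho ordp \<gamma> \<kappa> b' \<epsilon> \<rho>)"

text \<open>The parameter \<open>\<epsilon>\<close> has no influence on the following two spaces; it is kept because they
  are introduced as subsets of the spaces above.\<close>

definition R_space_rho ::
    "('a::field_char_0 \<Rightarrow> ereal) \<Rightarrow> 'a \<Rightarrow> 'a \<Rightarrow> real \<Rightarrow> real \<Rightarrow> real \<Rightarrow> 'a fps fps set" where
  "R_space_rho ordp \<gamma> \<kappa> b' \<epsilon> \<rho> =
     {F \<in> S_space_rho ordp \<gamma> \<kappa> b' \<epsilon> \<rho>. \<exists>G. F = fps_const G}"

definition R_space ::
    "('a::field_char_0 \<Rightarrow> ereal) \<Rightarrow> 'a \<Rightarrow> 'a \<Rightarrow> real \<Rightarrow> real \<Rightarrow> 'a fps fps set" where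
  "R_space ordp \<gamma> \<kappa> b' \<epsilon> = (\<Union>\<rho>. R_space_rho ordp \<gamma> \<kappa> b' \<epsilon> \<rho>)"

text \<open>The coefficient of \<open>w^(m)\<close> (a series in \<open>t\<close>), meaningful when \<open>\<kappa>\<close> is not a nonnegative
  integer, so that no falling factorial of \<open>\<kappa>\<close> vanishes.\<close>

definition w_coeff :: "'a::field \<Rightarrow> 'a fps fps \<Rightarrow> nat \<Rightarrow> 'a fps" where
  "w_coeff \<kappa> F m = fps_const (inverse (falling \<kappa> m)) * fps_nth F m"

text \<open>For \<open>m = 0\<close> the truncated index \<open>m - 1\<close> occurs with coefficient \<open>0\<close>.\<close>

definition L_kappa_basis :: "'a::field \<Rightarrow> (nat \<Rightarrow> nat \<Rightarrow> 'a fps) \<Rightarrow> nat \<Rightarrow> 'a fps fps" where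
  "L_kappa_basis \<kappa> H m =
     fps_const (fps_const (\<kappa> - of_nat m) * H 0 0) * w_div \<kappa> m
     + fps_const (H 0 1) * w_div \<kappa> (m + 1)
     + fps_const (fps_const (of_nat m * (\<kappa> - of_nat m + 1)) * H 1 0) * w_div \<kappa> (m - 1)
     + fps_const (of_nat m * H 1 1) * w_div \<kappa> m"

text \<open>Termwise extension.  The image of \<open>w^(m)\<close> only involves powers of \<open>w\<close> with exponent at
  least \<open>m - 1\<close>, so the coefficient of \<open>w^k\<close> receives contributions only from \<open>m \<le> k + 1\<close>.\<close>

definition L_kappa :: "'a::field \<Rightarrow> (nat \<Rightarrow> nat \<Rightarrow> 'a fps) \<Rightarrow> 'a fps fps \<Rightarrow> 'a fps fps" where
  "L_kappa \<kappa> H F =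
     Abs_fps (\<lambda>k. \<Sum>m\<le>k + 1. w_coeff \<kappa> F m * fps_nth (L_kappa_basis \<kappa> H m) k)"

definition t_ddt :: "'a::field fps fps \<Rightarrow> 'a fps fps" where
  "t_ddt F = Abs_fps (\<lambda>m. fps_X * fps_deriv (fps_nth F m))"

definition del_kappa :: "'a::field \<Rightarrow> (nat \<Rightarrow> nat \<Rightarrow> 'a fps) \<Rightarrow> 'a fps fps \<Rightarrow> 'a fps fps" where
  "del_kappa \<kappa> H F = t_ddt F + L_kappa \<kappa> H F"


section \<open>Cohomology\<close>

definition H0_kappa :: "'a::field \<Rightarrow> (nat \<Rightarrow> nat \<Rightarrow> 'a fps) \<Rightarrow> 'a fps fps set \<Rightarrow> 'a fps fps set" where
  "H0_kappa \<kappa> H S = {F \<in> S. del_kappa \<kappa> H F = 0}"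

definition H1_rel ::
    "'a::field \<Rightarrow> (nat \<Rightarrow> nat \<Rightarrow> 'a fps) \<Rightarrow> 'a fps fps set \<Rightarrow> 'a fps fps rel" where
  "H1_rel \<kappa> H S = {(F, G). F \<in> S \<and> G \<in> S \<and> F - G \<in> del_kappa \<kappa> H ` S}"

definition H1_kappa ::
    "'a::field \<Rightarrow> (nat \<Rightarrow> nat \<Rightarrow> 'a fps) \<Rightarrow> 'a fps fps set \<Rightarrow> 'a fps fps set set" where
  "H1_kappa \<kappa> H S = S // H1_rel \<kappa> H S"

definition H1_class ::
    "'a::field \<Rightarrow> (nat \<Rightarrow> nat \<Rightarrow> 'a fps) \<Rightarrow> 'a fps fps set \<Rightarrow> 'a fps fps \<Rightarrow> 'a fps fps set" where
  "H1_class \<kappa> H S F = H1_rel \<kappa> H S `` {F}"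

text \<open>\<open>\<phi>\<close> is an isomorphism of vector spaces over \<open>\<Omega>\<close> from the quotient of \<open>S\<close> by the image of
  \<open>del_kappa\<close> (with the operations induced from representatives) onto \<open>R\<close>, inverse to the
  map induced by the inclusion of \<open>R\<close> in \<open>S\<close>.  (\<open>del_kappa\<close> is not linear over
  power series in \<open>t\<close>, so the quotient is only a vector space over the coefficient field.)\<close>

definition is_H1_iso ::
    "'a::field set \<Rightarrow> 'a \<Rightarrow> (nat \<Rightarrow> nat \<Rightarrow> 'a fps) \<Rightarrow> 'a fps fps set \<Rightarrow> 'a fps fps set
      \<Rightarrow> ('a fps fps set \<Rightarrow> 'a fps fps) \<Rightarrow> bool" where
  "is_H1_iso \<Omega> \<kappa> H S R \<phi> \<longleftrightarrow>
     bij_betw \<phi> (H1_kappa \<kappa> H S) R \<and>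
     (\<forall>F\<in>S. \<forall>G\<in>S. \<phi> (H1_class \<kappa> H S (F + G)) = \<phi> (H1_class \<kappa> H S F) + \<phi> (H1_class \<kappa> H S G)) \<and>
     (\<forall>c\<in>\<Omega>. \<forall>F\<in>S. \<phi> (H1_class \<kappa> H S (fps_const (fps_const c) * F))
        = fps_const (fps_const c) * \<phi> (H1_class \<kappa> H S F)) \<and>
     (\<forall>F\<in>R. \<phi> (H1_class \<kappa> H S F) = F)"

text \<open>\<open>A = B \<oplus> C\<close> (internal direct sum) for additive subgroups; the sum of sets is elementwise.\<close>

definition is_direct_sum :: "'b::ab_group_add set \<Rightarrow> 'b set \<Rightarrow> 'b set \<Rightarrow> bool" where
  "is_direct_sum A B C \<longleftrightarrow> A = B + C \<and> B \<inter> C = {0}"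

end

theory Submission
  imports Defs
begin

text \<open>
  Put \<open>y = t/x\<close>, so that the formal series in question are the power series in \<open>x\<close> and \<open>y\<close> with
  \<open>t = x y\<close>, and \<open>W\<^sub>1 = \<Sum> w\<^sub>j (x^(p^j) - y^(p^j))\<close>.  Summing coefficients along antidiagonals
  (setting \<open>x = y\<close> in each degree) kills the multiples of \<open>W\<^sub>1\<close>, and partial sums recover the
  cofactor with a gain of \<open>\<epsilon>\<close>.  Since \<open>x\<partial>/\<partial>x\<close> does not lower valuations, this bootstraps to
  estimates for every solution of \<open>F = h\<^sub>0 + h\<^sub>1 \<gamma>t/x + D \<xi>\<close>.  As \<open>W\<^sub>2\<close> has only odd degrees, the
  matrix satisfies \<open>H\<^sub>0\<^sub>0, H\<^sub>0\<^sub>1, H\<^sub>1\<^sub>1 \<in> L(b';0)\<close> and \<open>H\<^sub>1\<^sub>0 \<in> L(b';-2\<epsilon>)\<close>, the constant term of \<open>H\<^sub>0\<^sub>1\<close>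
  is a unit and that of \<open>H\<^sub>1\<^sub>0\<close> vanishes.

  Consequently, for fixed \<open>n\<close> and given lower coefficients in \<open>t\<close>, the equation for the
  coefficients of \<open>t^n w^(m+1)\<close> is a recursion \<open>a\<^sub>m = c\<^sub>m + l\<^sub>m a\<^sub>m\<^sub>+\<^sub>1\<close> with integral \<open>l\<^sub>m\<close> and
  \<open>ord c\<^sub>m\<close> growing like \<open>\<epsilon> m\<close>.  It has exactly one solution of at least linear growth, the convergent
  series \<open>\<Sum> l\<^sub>m \<dots> l\<^sub>m\<^sub>+\<^sub>k\<^sub>-\<^sub>1 c\<^sub>m\<^sub>+\<^sub>k\<close>.  Convergence uses that \<open>\<Omega>\<^sub>0\<close> is complete: \<open>\<gamma>^(p-1)\<close> lies in
  \<open>\<rat>\<^sub>p\<close>, so \<open>\<Omega>\<^sub>0\<close> has the orthogonal basis \<open>1, \<gamma>, \<dots>, \<gamma>^(p-2)\<close> over \<open>\<rat>\<^sub>p\<close>.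
\<close>

section \<open>Valuations and \<open>\<rat>\<^sub>p\<close>\<close>

context Qp_algebraic_closure
begin

text \<open>\<open>real_of_ereal\<close> sends \<infinity> to 0, so \<open>val 0 = 0\<close>;
  estimates that have to cover 0 are therefore phrased with \<open>vge\<close>.\<close>

definition val :: "'a \<Rightarrow> real" where
  "val x = real_of_ereal (ordp x)"

definition vge :: "'a \<Rightarrow> real \<Rightarrow> bool" where
  "vge x r \<longleftrightarrow> ereal r \<le> ordp x"

lemma ordp_0 [simp]: "ordp 0 = \<infinity>"
  by (simp add: ordp_eq_PInf_iff)

lemma ordp_eq_val: "x \<noteq> 0 \<Longrightarrow> ordp x = ereal (val x)"
  using ordp_eq_PInf_iff[of x] ordp_not_MInf[of x] unfolding val_def
  by (cases "ordp x") auto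

lemma val_mult: "x \<noteq> 0 \<Longrightarrow> y \<noteq> 0 \<Longrightarrow> val (x * y) = val x + val y"
  using ordp_mult[of x y] by (simp add: ordp_eq_val)

lemma vge_iff: "vge x r \<longleftrightarrow> x = 0 \<or> r \<le> val x"
  by (cases "x = 0") (auto simp: vge_def ordp_eq_val)

lemma vge_0 [simp]: "vge 0 r"
  by (simp add: vge_iff)

lemma val_1 [simp]: "val 1 = 0"
  using val_mult[of 1 1] by simp

lemma val_minus [simp]: "val (- x) = val x"
proof (cases "x = 0")
  case False
  have "val (-1) = 0" using val_mult[of "-1" "-1"] by simp
  then show ?thesis using val_mult[of "-1" x] False by simp
qed auto

lemma val_inverse: "x \<noteq> 0 \<Longrightarrow> val (inverse x) = - val x"
  using val_mult[of x "inverse x"] by simp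

lemma val_divide: "x \<noteq> 0 \<Longrightarrow> y \<noteq> 0 \<Longrightarrow> val (x / y) = val x - val y"
  by (simp add: divide_inverse val_mult val_inverse)

lemma val_power: "x \<noteq> 0 \<Longrightarrow> val (x ^ n) = real n * val x"
  by (induction n) (auto simp: val_mult algebra_simps)

lemma val_p [simp]: "val (of_nat p) = 1"
  by (simp add: val_def ordp_p)

lemma p_gt_0 [simp]: "p > 0"
  using prime_p prime_gt_0_nat by blast

lemma vge_mono: "vge x r \<Longrightarrow> s \<le> r \<Longrightarrow> vge x s"
  by (auto simp: vge_iff)

lemma vge_add: "vge x r \<Longrightarrow> vge y r \<Longrightarrow> vge (x + y) r"
  using ordp_add[of x y] unfolding vge_def by (auto simp: min_def split: if_splits)

lemma vge_minus [simp]: "vge (- x) r \<longleftrightarrow> vge x r"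
  by (simp add: vge_iff)

lemma vge_diff: "vge x r \<Longrightarrow> vge y r \<Longrightarrow> vge (x - y) r"
  using vge_add[of x r "- y"] by simp

lemma vge_diff_commute: "vge (x - y) r \<longleftrightarrow> vge (y - x) r"
  using vge_minus[of "x - y"] by simp

lemma vge_sum: "(\<And>i. i \<in> I \<Longrightarrow> vge (f i) r) \<Longrightarrow> vge (sum f I) r"
  by (induction I rule: infinite_finite_induct) (auto intro: vge_add)

lemma vge_mult: "vge x r \<Longrightarrow> vge y s \<Longrightarrow> vge (x * y) (r + s)"
  by (cases "x = 0"; cases "y = 0") (auto simp: vge_iff val_mult)

lemma vge_mult_le: "vge x r \<Longrightarrow> vge y s \<Longrightarrow> q \<le> r + s \<Longrightarrow> vge (x * y) q"
  using vge_mult vge_mono by blast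

lemma vge_1 [simp]: "vge 1 0"
  by (simp add: vge_iff)

lemma vge_of_nat [simp]: "vge (of_nat n) 0"
  by (induction n) (auto intro: vge_add)

lemma vge_of_int [simp]: "vge (of_int n) 0"
  by (cases n rule: int_cases2) auto

lemma vge_of_nat_mult: "vge x r \<Longrightarrow> vge (of_nat n * x) r"
  using vge_mult[of "of_nat n" 0 x r] by simp

lemma vge_of_int_mult: "vge x r \<Longrightarrow> vge (of_int n * x) r"
  using vge_mult[of "of_int n" 0 x r] by simp

lemma vge_power: "vge x r \<Longrightarrow> vge (x ^ n) (real n * r)"
  by (induction n) (auto simp: algebra_simps intro: vge_mult)

lemma vge_all_imp_0: "(\<And>r. vge x r) \<Longrightarrow> x = 0"
  by (metis vge_iff gt_ex leD)

text \<open>The strict case of the ultrametric inequality: if \<open>x + y\<close> had larger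
  valuation than \<open>x\<close>, then so would \<open>x = (x + y) - y\<close>.\<close>

lemma val_add_eq:
  assumes "x \<noteq> 0" "vge y r" "val x < r"
  shows "x + y \<noteq> 0" "val (x + y) = val x"
proof -
  show nz: "x + y \<noteq> 0"
    using assms by (metis add.inverse_unique leD vge_iff vge_minus)
  have "vge (x + y) (val x)"
    using assms by (intro vge_add) (auto simp: vge_iff)
  moreover have "\<not> val x < val (x + y)"
  proof
    assume *: "val x < val (x + y)"
    define s where "s = min r (val (x + y))"
    have "vge ((x + y) - y) s"
      using assms(2) by (intro vge_diff) (auto simp: vge_iff s_def)
    then show False using assms * by (auto simp: vge_iff s_def)
  qed
  ultimately show "val (x + y) = val x"
    using nz by (auto simp: vge_iff)
qed

lemma vge_uniq_limit:
  fixes s :: "nat \<Rightarrow> 'a"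
  assumes "\<And>M. \<exists>N. \<forall>n\<ge>N. vge (x - s n) M" "\<And>M. \<exists>N. \<forall>n\<ge>N. vge (y - s n) M"
  shows "x = y"
proof -
  have "vge (x - y) M" for M
  proof -
    obtain N1 N2 where "\<forall>n\<ge>N1. vge (x - s n) M" "\<forall>n\<ge>N2. vge (y - s n) M"
      using assms by meson
    then have "vge (x - s (max N1 N2)) M" "vge (y - s (max N1 N2)) M" by simp_all
    from vge_diff[OF this] have "vge (x - y) M" by simp
    then show ?thesis by simp
  qed
  then show ?thesis using vge_all_imp_0[of "x - y"] by simp
qed

section \<open>Valuations of rational numbers\<close>

lemma val_of_int_coprime:
  assumes "\<not> int p dvd n"
  shows "val (of_int n) = 0"
proof -
  have "coprime (int p) n"
    using assms prime_p by (simp add: prime_imp_coprime)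
  then obtain a b where ab: "a * int p + b * n = 1"
    by (metis bezout_int coprime_imp_gcd_eq_1)
  \<comment> \<open>The right side is a unit because \<open>p\<close> has positive valuation; both
    factors on the left have nonnegative valuation, so both are units.\<close>
  then have eq: "of_int b * of_int n = (1 - of_int a * of_nat p :: 'a)"
    by (metis (no_types, lifting) add_diff_cancel_left' of_int_1 of_int_add of_int_mult of_int_of_nat_eq)
  have "vge (of_int a * of_nat p) 1"
    using vge_of_int_mult[of "of_nat p" 1 a] by (simp add: vge_iff)
  then have *: "1 + - (of_int a * of_nat p) \<noteq> (0::'a)" "val (1 + - (of_int a * of_nat p)) = 0"
    using val_add_eq[of 1 "- (of_int a * of_nat p)" 1] by simp_all
  have nz: "of_int n \<noteq> (0::'a)" "of_int b \<noteq> (0::'a)"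
    using eq *(1) by (auto simp flip: of_int_mult)
  have "val (of_int b) + val (of_int n) = 0"
    using *(2) eq nz by (simp flip: val_mult)
  moreover have "val (of_int b) \<ge> 0" "val (of_int n) \<ge> 0"
    using vge_of_int[of b] vge_of_int[of n] nz by (simp_all only: vge_iff) auto
  ultimately show ?thesis by linarith
qed

lemma val_of_int_Ints:
  assumes "n \<noteq> 0"
  shows "val (of_int n) \<in> \<int>"
proof -
  have "\<not> is_unit (int p)" using prime_p by auto
  then obtain m where m: "n = int p ^ multiplicity (int p) n * m" "\<not> int p dvd m"
    using multiplicity_decompose'[of n "int p"] assms by (metis mult.commute)
  then have "of_int n = of_nat p ^ multiplicity (int p) n * (of_int m :: 'a)"
    by (metis of_int_mult of_int_of_nat_eq of_int_power)
  moreover have "m \<noteq> 0" using m(2) by auto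
  ultimately have "val (of_int n) = real (multiplicity (int p) n)"
    using val_of_int_coprime[OF m(2)] by (simp add: val_mult val_power)
  then show ?thesis by simp
qed

lemma val_of_rat_Ints: "q \<noteq> 0 \<Longrightarrow> val (of_rat q) \<in> \<int>"
  by (cases q) (auto simp: Fract_of_int_quotient of_rat_divide val_divide intro!: Ints_diff val_of_int_Ints)

section \<open>Arithmetic, value group and completeness of \<open>Qp ordp\<close>\<close>

lemma Qp_iff: "x \<in> Qp ordp \<longleftrightarrow> (\<forall>M. \<exists>q. vge (x - of_rat q) M)"
  by (auto simp: Qp_def vge_def)

lemma of_rat_in_Qp [simp]: "of_rat q \<in> Qp ordp"
  by (auto simp: Qp_iff intro!: exI[of _ q])

lemma zero_in_Qp [simp]: "0 \<in> Qp ordp"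
  using of_rat_in_Qp[of 0] by simp

lemma one_in_Qp [simp]: "1 \<in> Qp ordp"
  using of_rat_in_Qp[of 1] by simp

lemma Qp_add: "x \<in> Qp ordp \<Longrightarrow> y \<in> Qp ordp \<Longrightarrow> x + y \<in> Qp ordp"
  unfolding Qp_iff
proof
  fix M assume "\<forall>M. \<exists>q. vge (x - of_rat q) M" "\<forall>M. \<exists>q. vge (y - of_rat q) M"
  then obtain q r where "vge (x - of_rat q) M" "vge (y - of_rat r) M" by meson
  then have "vge (x - of_rat q + (y - of_rat r)) M" by (rule vge_add)
  then show "\<exists>q. vge (x + y - of_rat q) M"
    by (intro exI[of _ "q + r"]) (simp add: of_rat_add algebra_simps)
qed

lemma vge_bounded_below: "\<exists>r. vge x r"
  by (auto simp: vge_iff)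

lemma Qp_mult: assumes "x \<in> Qp ordp" "y \<in> Qp ordp" shows "x * y \<in> Qp ordp"
  unfolding Qp_iff
proof
  fix M
  obtain r where r: "vge x r" using vge_bounded_below by blast
  obtain q where q: "vge (y - of_rat q) (M - r)" using assms unfolding Qp_iff by meson
  \<comment> \<open>The precision required for \<open>x\<close> depends on the approximation
    \<open>q\<close> of \<open>y\<close>, so \<open>q\<close> is fixed first.\<close>
  obtain s where s: "vge (of_rat q) s" using vge_bounded_below by blast
  obtain q' where q': "vge (x - of_rat q') (M - s)" using assms unfolding Qp_iff by meson
  have "vge (x * (y - of_rat q) + (x - of_rat q') * of_rat q) M"
    by (intro vge_add vge_mult_le[OF r q] vge_mult_le[OF q' s]) auto
  then show "\<exists>q. vge (x * y - of_rat q) M"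
    by (intro exI[of _ "q' * q"]) (simp add: of_rat_mult algebra_simps)
qed

lemma Qp_minus: "x \<in> Qp ordp \<Longrightarrow> - x \<in> Qp ordp"
  using Qp_mult[of "of_rat (-1)" x, OF of_rat_in_Qp] by (simp add: of_rat_minus)

lemma Qp_diff: "x \<in> Qp ordp \<Longrightarrow> y \<in> Qp ordp \<Longrightarrow> x - y \<in> Qp ordp"
  using Qp_add[of x "-y"] Qp_minus by simp

lemma Qp_approx_val:
  assumes "x \<in> Qp ordp" "x \<noteq> 0"
  obtains q where "q \<noteq> 0" "vge (x - of_rat q) M" "val (of_rat q) = val x"
proof -
  \<comment> \<open>An error of larger valuation than \<open>x\<close> forces the approximation to
    have the valuation of \<open>x\<close>.\<close>
  obtain q where q: "vge (x - of_rat q) (max M (val x + 1))"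
    using assms unfolding Qp_iff by meson
  then have "x + (of_rat q - x) \<noteq> 0" "val (x + (of_rat q - x)) = val x"
    using val_add_eq[of x "of_rat q - x" "max M (val x + 1)"] assms
    by (simp_all add: vge_diff_commute)
  then show thesis using that[of q] vge_mono[OF q] by simp
qed

lemma val_Qp_Ints: "x \<in> Qp ordp \<Longrightarrow> x \<noteq> 0 \<Longrightarrow> val x \<in> \<int>"
  by (metis Qp_approx_val val_of_rat_Ints)

lemma Qp_inverse: assumes "x \<in> Qp ordp" shows "inverse x \<in> Qp ordp"
proof (cases "x = 0")
  case False
  show ?thesis unfolding Qp_iff
  proof
    fix M
    obtain q where q: "q \<noteq> 0" "vge (x - of_rat q) (M + 2 * val x)" "val (of_rat q) = val x"
      using Qp_approx_val[OF assms False] by metis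
    have *: "inverse x - of_rat (inverse q) = (of_rat q - x) * inverse (x * of_rat q)"
      unfolding of_rat_inverse using q(1) False by (simp add: field_simps)
    have "vge (inverse (x * of_rat q)) (- 2 * val x)"
      using q False by (simp add: vge_iff val_inverse val_mult)
    then have "vge (inverse x - of_rat (inverse q)) M"
      unfolding * using q(2) by (intro vge_mult_le[where r = "M + 2 * val x" and s = "- 2 * val x"]) (auto simp: vge_diff_commute)
    then show "\<exists>q. vge (inverse x - of_rat q) M" by blast
  qed
qed simp

text \<open>Completeness is given for rational sequences. Replacing \<open>s n\<close> by a rational
  number that differs from it by valuation at least \<open>n\<close> changes neither the Cauchy
  property nor the limit.\<close>

lemma Qp_Cauchy_convergent:
  assumes s: "\<And>n. s n \<in> Qp ordp"
    and C: "\<And>M. \<exists>N::nat. \<forall>i\<ge>N. \<forall>j\<ge>N. vge (s i - s j) M"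
  obtains x where "x \<in> Qp ordp" "\<And>M. \<exists>N. \<forall>n\<ge>N. vge (x - s n) M"
proof -
  have "\<exists>q. vge (s n - of_rat q) (real n)" for n
    using s[of n] unfolding Qp_iff by blast
  then obtain q where q: "\<And>n. vge (s n - of_rat (q n)) (real n)" by metis
  have "\<exists>N. \<forall>i\<ge>N. \<forall>j\<ge>N. vge (of_rat (q i) - of_rat (q j)) M" for M
  proof -
    obtain N where N: "\<forall>i\<ge>N. \<forall>j\<ge>N. vge (s i - s j) M" using C by blast
    have "vge (of_rat (q i) - of_rat (q j)) M"
      if "i \<ge> max N (nat \<lceil>M\<rceil>)" "j \<ge> max N (nat \<lceil>M\<rceil>)" for i j
    proof -
      have *: "vge (s i - of_rat (q i)) M" "vge (s j - of_rat (q j)) M"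
        using that by (auto intro!: vge_mono[OF q])
      have "vge ((s i - s j) - (s i - of_rat (q i)) + (s j - of_rat (q j))) M"
        by (rule vge_add[OF vge_diff[OF _ *(1)] *(2)]) (use N that in auto)
      then show ?thesis by (simp add: algebra_simps)
    qed
    then show ?thesis by blast
  qed
  then obtain x where x: "(\<lambda>i. ordp (x - of_rat (q i))) \<longlonglongrightarrow> \<infinity>"
    using Qp_complete[of q] unfolding vge_def by blast
  have xq: "\<exists>N. \<forall>n\<ge>N. vge (x - of_rat (q n)) M" for M
    using x unfolding tendsto_PInfty eventually_sequentially vge_def by (meson less_imp_le)
  then have "x \<in> Qp ordp" unfolding Qp_iff by (meson order_refl)
  moreover have "\<exists>N. \<forall>n\<ge>N. vge (x - s n) M" for M
  proof -
    obtain N where N: "\<forall>n\<ge>N. vge (x - of_rat (q n)) M" using xq by blast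
    have "vge (x - s n) M" if "n \<ge> max N (nat \<lceil>M\<rceil>)" for n
    proof -
      have *: "vge (s n - of_rat (q n)) M"
        using that by (auto intro!: vge_mono[OF q])
      have "vge ((x - of_rat (q n)) - (s n - of_rat (q n))) M"
        by (rule vge_diff[OF _ *]) (use N that in auto)
      then show ?thesis by (simp add: algebra_simps)
    qed
    then show ?thesis by blast
  qed
  ultimately show thesis using that by blast
qed

end

section \<open>Completeness of \<open>\<Omega>\<^sub>0\<close>\<close>

context Qp_algebraic_closure
begin

text \<open>When the nonzero terms have distinct valuations, the term of least valuation cannot be
  cancelled, so the whole sum has this valuation.\<close>

lemma vge_sum_distinct_val:
  assumes "finite I" and inj: "\<And>i j. i \<in> I \<Longrightarrow> j \<in> I \<Longrightarrow> f i \<noteq> 0 \<Longrightarrow> f j \<noteq> 0 \<Longrightarrow> val (f i) = val (f j) \<Longrightarrow> i = j"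
    and "vge (sum f I) M" "i \<in> I"
  shows "vge (f i) M"
proof (cases "f i = 0")
  case False
  define J where "J = {j\<in>I. f j \<noteq> 0}"
  have J: "finite J" "i \<in> J" using assms False by (auto simp: J_def)
  have "Min ((\<lambda>k. val (f k)) ` J) \<in> (\<lambda>k. val (f k)) ` J"
    using J by (intro Min_in) auto
  then obtain j where "j \<in> J" "val (f j) = Min ((\<lambda>k. val (f k)) ` J)" by auto
  then have j: "j \<in> J" "\<And>k. k \<in> J \<Longrightarrow> val (f j) \<le> val (f k)"
    using J(1) by auto
  have sum_eq: "sum f I = f j + sum f (J - {j})"
    using sum.remove[OF J(1) j(1), of f] assms(1)
    by (simp add: J_def sum.mono_neutral_cong_right[of I "{j\<in>I. f j \<noteq> 0}" f f])
  have nz: "f j \<noteq> 0" using j by (auto simp: J_def)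
  \<comment> \<open>\<open>r\<close> is the second smallest valuation, or any number above
    \<open>val (f j)\<close> when \<open>f j\<close> is the only nonzero term.\<close>
  obtain r where r: "val (f j) < r" "\<And>k. k \<in> J - {j} \<Longrightarrow> r \<le> val (f k)"
  proof (cases "J - {j} = {}")
    case True
    then show thesis using that[of "val (f j) + 1"] by auto
  next
    case False
    define r where "r = Min ((\<lambda>k. val (f k)) ` (J - {j}))"
    have "r \<in> (\<lambda>k. val (f k)) ` (J - {j})" unfolding r_def using False J by (intro Min_in) auto
    then obtain k where k: "k \<in> J" "k \<noteq> j" "r = val (f k)" by auto
    then have "val (f j) \<noteq> r" using inj[of j k] j k by (auto simp: J_def)
    then have "val (f j) < r" using j(2)[of k] k by auto
    moreover have "r \<le> val (f k)" if "k \<in> J - {j}" for k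
      unfolding r_def using that J by (intro Min_le) auto
    ultimately show thesis using that by blast
  qed
  have "vge (sum f (J - {j})) r"
    using r(2) by (intro vge_sum) (auto simp: vge_iff)
  then have "sum f I \<noteq> 0" "val (sum f I) = val (f j)"
    unfolding sum_eq using val_add_eq[OF nz _ r(1)] by blast+
  then show ?thesis using assms(3) j(2)[OF J(2)] by (auto simp: vge_iff)
qed simp

end

locale splitting_root = Qp_algebraic_closure p ordp
  for p and ordp :: "'a::{alg_closed_field, field_char_0} \<Rightarrow> ereal" +
  fixes \<gamma> :: 'a
  assumes p_ge: "p \<ge> 5" and root: "is_splitting_root p ordp \<gamma>"
begin

section \<open>The root \<gamma> and the coefficients of \<open>W1\<close> and
  \<open>W2\<close>\<close>

lemma ordp_gamma: "ordp \<gamma> = ereal (1 / (real p - 1))"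
  using root by (simp add: is_splitting_root_def)

lemma gamma_nz [simp]: "\<gamma> \<noteq> 0"
  using ordp_gamma ordp_eq_PInf_iff[of \<gamma>] by auto

lemma val_gamma [simp]: "val \<gamma> = 1 / (real p - 1)"
  by (simp add: val_def ordp_gamma)

lemma gamma_part_tendsto: "\<exists>N. \<forall>n\<ge>N. vge (gamma_part p \<gamma> n) M"
  using root unfolding is_splitting_root_def tendsto_PInfty eventually_sequentially vge_def
  by (meson less_imp_le)

text \<open>The expression is the valuation of \<open>\<gamma> ^ (p ^ i) / of_nat p ^ i\<close>.
  From \<open>n\<close> to \<open>n + 1\<close> it grows by p^n - 1, which is nonnegative.\<close>

lemma gamma_term_mono:
  assumes "i \<le> j"
  shows "real (p ^ i) / (real p - 1) - real i \<le> real (p ^ j) / (real p - 1) - real j"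
  using assms
proof (induction j rule: dec_induct)
  case (step n)
  have "real (p ^ Suc n) / (real p - 1) - real (p ^ n) / (real p - 1) = real (p ^ n)"
    using p_ge by (simp add: diff_divide_distrib[symmetric] divide_eq_eq) (simp add: algebra_simps)
  moreover have "real (p ^ n) \<ge> 1" using p_gt_0 by (metis One_nat_def Suc_leI of_nat_1 of_nat_mono zero_less_power)
  ultimately show ?case using step by simp
qed simp

text \<open>Since \<gamma> is a root, a partial sum is minus the remaining tail up to an arbitrarily
  small error, and no term of the tail has smaller valuation than the first omitted one.\<close>

lemma vge_gamma_part: "vge (gamma_part p \<gamma> l) (real (p ^ Suc l) / (real p - 1) - real (Suc l))"
    (is "vge _ ?M")
proof -
  obtain N where N: "\<forall>n\<ge>N. vge (gamma_part p \<gamma> n) ?M" using gamma_part_tendsto by blast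
  define L where "L = max N l"
  have "{..L} = {..l} \<union> {Suc l..L}" unfolding L_def by auto
  then have eq: "gamma_part p \<gamma> L = gamma_part p \<gamma> l + (\<Sum>i\<in>{Suc l..L}. \<gamma> ^ (p ^ i) / of_nat p ^ i)"
    unfolding gamma_part_def by (simp only:) (rule sum.union_disjoint, auto)
  have "vge (\<Sum>i\<in>{Suc l..L}. \<gamma> ^ (p ^ i) / of_nat p ^ i) ?M"
  proof (intro vge_sum)
    fix i assume "i \<in> {Suc l..L}"
    then show "vge (\<gamma> ^ (p ^ i) / of_nat p ^ i) ?M"
      using gamma_term_mono[of "Suc l" i] by (simp add: vge_iff val_divide val_power)
  qed
  moreover have "vge (gamma_part p \<gamma> L) ?M" using N by (simp add: L_def)
  ultimately have "vge (gamma_part p \<gamma> L - (\<Sum>i\<in>{Suc l..L}. \<gamma> ^ (p ^ i) / of_nat p ^ i)) ?M"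
    by (intro vge_diff)
  then show ?thesis using eq by simp
qed

text \<open>The coefficient of x^(p^j) in \<open>W1\<close> and of (t/x)^(p^j) in
  \<open>W2\<close>.\<close>

definition w_coef :: "nat \<Rightarrow> 'a" where
  "w_coef j = gamma_part p \<gamma> j * of_nat p ^ j"

lemma w_coef_0 [simp]: "w_coef 0 = \<gamma>"
  by (simp add: w_coef_def gamma_part_def)

text \<open>The factor \<open>p ^ j\<close> makes up for all but 1 of the loss \<open>Suc j\<close>
  in the bound for \<open>gamma_part\<close>.\<close>

lemma vge_w_coef: "vge (w_coef j) (real p / (real p - 1) * real (p ^ j) - 1)"
proof -
  have "vge (of_nat p ^ j) (real j)" by (simp add: vge_iff val_power)
  then have "vge (w_coef j) (real (p ^ Suc j) / (real p - 1) - real (Suc j) + real j)"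
    unfolding w_coef_def by (rule vge_mult[OF vge_gamma_part])
  then show ?thesis by simp
qed

section \<open>The power \<gamma>^(p-1) lies in \<open>Qp ordp\<close>\<close>

abbreviation (input) e :: "nat \<Rightarrow> nat" where "e i \<equiv> (\<Sum>k<i. p ^ k)"

text \<open>The exponent \<open>e i\<close> is the geometric sum (p^i - 1)/(p - 1).\<close>

lemma gamma_power: "\<gamma> ^ (p ^ i) = \<gamma> * (\<gamma> ^ (p - 1)) ^ e i"
proof -
  have "p ^ i = Suc ((p - 1) * e i)"
  proof (induction i)
    case (Suc i)
    have "p ^ Suc i = p ^ i + (p - 1) * p ^ i"
      using p_gt_0 by (metis Suc_diff_1 mult_Suc power_Suc)
    also have "\<dots> = Suc ((p - 1) * e i + (p - 1) * p ^ i)"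
      using Suc by presburger
    also have "\<dots> = Suc ((p - 1) * e (Suc i))"
      by (simp only: sum.lessThan_Suc distrib_left)
    finally show ?case .
  qed simp
  then show ?thesis by (simp add: power_mult)
qed

text \<open>This is what outweighs the denominator \<open>p ^ i\<close> in the contraction estimate
  of \<open>gamma_power_in_Qp\<close>.\<close>

lemma e_ge: "i \<ge> 2 \<Longrightarrow> e i \<ge> Suc i"
proof (induction i rule: dec_induct)
  case (step n)
  moreover have "p ^ n \<ge> 1" using p_gt_0 by (metis One_nat_def Suc_leI zero_less_power)
  ultimately show ?case by simp
qed (use p_ge in \<open>simp add: numeral_2_eq_2\<close>)

text \<open>After factoring out \<open>x - y\<close>, all terms of the cofactor have degree
  \<open>n - 1\<close>, hence valuation at least \<open>n - 1\<close>.\<close>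

lemma vge_power_diff:
  assumes "vge x 1" "vge y 1" "vge (x - y) M" "n > 0"
  shows "vge (x ^ n - y ^ n) (M + real n - 1)"
proof -
  have *: "vge (\<Sum>i<n. y ^ (n - Suc i) * x ^ i) (real n - 1)"
  proof (intro vge_sum)
    fix i assume "i \<in> {..<n}"
    then show "vge (y ^ (n - Suc i) * x ^ i) (real n - 1)"
      using vge_mult[OF vge_power[OF assms(2), of "n - Suc i"] vge_power[OF assms(1), of i]]
      by (simp add: of_nat_diff)
  qed
  show ?thesis
    unfolding power_diff_sumr2 using vge_mult[OF assms(3) *] by (simp add: algebra_simps)
qed

text \<open>Dividing the equation for \<open>\<gamma>\<close> by \<open>\<gamma>\<close> gives a fixed point equation for
  \<open>u = \<gamma>^(p-1)\<close> with rational coefficients that is contracting on \<open>ord \<ge> 1\<close>.\<close>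

lemma gamma_power_in_Qp: "\<gamma> ^ (p - 1) \<in> Qp ordp"
proof -
  define u where "u = \<gamma> ^ (p - 1)"
  have "val u = 1" using p_ge by (simp add: u_def val_power of_nat_diff)
  then have u1: "vge u 1" by (simp add: vge_iff)
  have unz: "u \<noteq> 0" by (simp add: u_def)
  \<comment> \<open>The terms \<open>i = 0\<close> and \<open>i = 1\<close> of the equation divided
    by \<gamma> are \<open>1\<close> and \<open>u / p\<close>; solving for this \<open>u\<close>
    gives \<Phi>, truncated at \<open>N\<close>.\<close>
  define \<Phi> where "\<Phi> N x = - of_nat p * (1 + (\<Sum>i\<in>{2..N}. x ^ e i / of_nat p ^ i))" for N and x :: 'a
  have fix_u: "u - \<Phi> N u = of_nat p * gamma_part p \<gamma> N / \<gamma>" if "N \<ge> 1" for N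
  proof -
    have "{..N} = {0,1} \<union> {2..N}" using that by auto
    then have "gamma_part p \<gamma> N = (\<Sum>i\<in>{0,1} \<union> {2..N}. \<gamma> * (u ^ e i / of_nat p ^ i))"
      unfolding gamma_part_def by (simp add: gamma_power u_def)
    also have "\<dots> = (\<Sum>i\<in>{0,1}. \<gamma> * (u ^ e i / of_nat p ^ i)) + (\<Sum>i\<in>{2..N}. \<gamma> * (u ^ e i / of_nat p ^ i))"
      by (rule sum.union_disjoint) auto
    also have "\<dots> = \<gamma> * (1 + u / of_nat p + (\<Sum>i\<in>{2..N}. u ^ e i / of_nat p ^ i))"
      by (simp add: sum_distrib_left algebra_simps)
    finally show ?thesis unfolding \<Phi>_def by (simp add: field_simps)
  qed
  \<comment> \<open>Applying \<Phi> with \<open>N\<close> large keeps the approximation rational and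
    gains 1 in precision.\<close>
  have "\<exists>q. vge (u - of_rat q) (real (Suc m))" for m
  proof (induction m)
    case 0
    show ?case using u1 by (intro exI[of _ 0]) simp
  next
    case (Suc m)
    then obtain q where q: "vge (u - of_rat q) (real (Suc m))" by blast
    have q1: "vge (of_rat q) 1"
      using vge_diff[OF u1 vge_mono[OF q, of 1]] by simp
    obtain N0 where N0: "\<forall>n\<ge>N0. vge (gamma_part p \<gamma> n) (real (Suc m) + val \<gamma>)"
      using gamma_part_tendsto by blast
    define N where "N = max N0 1"
    have "vge (of_nat p * gamma_part p \<gamma> N / \<gamma>) (real (Suc (Suc m)))"
    proof -
      have "vge (inverse \<gamma>) (- val \<gamma>)" by (simp add: vge_iff val_inverse del: val_gamma)
      moreover have "vge (of_nat p * gamma_part p \<gamma> N) (1 + (real (Suc m) + val \<gamma>))"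
        using N0 by (intro vge_mult) (auto simp: vge_iff N_def)
      ultimately have "vge (of_nat p * gamma_part p \<gamma> N * inverse \<gamma>) (1 + (real (Suc m) + val \<gamma>) + - val \<gamma>)"
        using vge_mult by blast
      then show ?thesis by (simp add: divide_inverse)
    qed
    then have A: "vge (u - \<Phi> N u) (real (Suc (Suc m)))" using fix_u[of N] by (simp add: N_def)
    have "vge (\<Sum>i\<in>{2..N}. (u ^ e i - of_rat q ^ e i) / of_nat p ^ i) (real (Suc m))"
    proof (intro vge_sum)
      fix i assume i: "i \<in> {2..N}"
      have ei: "e i \<ge> Suc i" using e_ge i by simp
      have "vge (u ^ e i - of_rat q ^ e i) (real (Suc m) + real (e i) - 1)"
        using ei by (intro vge_power_diff u1 q1 q) linarith
      moreover have "vge (inverse (of_nat p ^ i)) (- real i)"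
        by (simp add: vge_iff val_inverse val_power)
      \<comment> \<open>The power difference gains \<open>e i - 1\<close>, which is at least the
        loss \<open>i\<close> from the denominator.\<close>
      ultimately show "vge ((u ^ e i - of_rat q ^ e i) / of_nat p ^ i) (real (Suc m))"
        unfolding divide_inverse by (rule vge_mult_le) (use ei in linarith)
    qed
    then have "vge (of_nat p * (\<Sum>i\<in>{2..N}. (u ^ e i - of_rat q ^ e i) / of_nat p ^ i)) (1 + real (Suc m))"
      by (intro vge_mult) (auto simp: vge_iff)
    moreover have "\<Phi> N (of_rat q) - \<Phi> N u = of_nat p * (\<Sum>i\<in>{2..N}. (u ^ e i - of_rat q ^ e i) / of_nat p ^ i)"
      unfolding \<Phi>_def by (simp add: diff_divide_distrib sum_subtractf algebra_simps)
    ultimately have "vge (\<Phi> N (of_rat q) - \<Phi> N u) (real (Suc (Suc m)))" by simp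
    then have "vge ((u - \<Phi> N u) - (\<Phi> N (of_rat q) - \<Phi> N u)) (real (Suc (Suc m)))"
      using A vge_diff by blast
    then have B: "vge (u - \<Phi> N (of_rat q)) (real (Suc (Suc m)))" by simp
    have "\<Phi> N (of_rat q) = of_rat (- of_nat p * (1 + (\<Sum>i\<in>{2..N}. q ^ e i / of_nat p ^ i)))"
      unfolding \<Phi>_def
      by (simp only: of_rat_minus of_rat_mult of_rat_add of_rat_sum of_rat_divide of_rat_power of_rat_of_nat_eq of_rat_1)
    then show ?case using B by metis
  qed
  then have "\<exists>q. vge (u - of_rat q) M" for M
    by (meson vge_mono real_nat_ceiling_ge le_SucI of_nat_mono order_refl order_trans)
  then show ?thesis by (simp add: Qp_iff u_def)
qed

section \<open>Coordinates of \<open>Omega0\<close> over \<open>Qp ordp\<close>\<close>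

definition coord_space :: "'a set" where
  "coord_space = {\<Sum>i<p - 1. a i * \<gamma> ^ i |a. \<forall>i. a i \<in> Qp ordp}"

lemma coord_spaceI: "(\<And>i. a i \<in> Qp ordp) \<Longrightarrow> (\<Sum>i<p - 1. a i * \<gamma> ^ i) \<in> coord_space"
  by (auto simp: coord_space_def)

lemma coord_space_add: "x \<in> coord_space \<Longrightarrow> y \<in> coord_space \<Longrightarrow> x + y \<in> coord_space"
  unfolding coord_space_def
proof clarify
  fix a c :: "nat \<Rightarrow> 'a" assume "\<forall>i. a i \<in> Qp ordp" "\<forall>i. c i \<in> Qp ordp"
  then show "\<exists>d. (\<Sum>i<p - 1. a i * \<gamma> ^ i) + (\<Sum>i<p - 1. c i * \<gamma> ^ i) = (\<Sum>i<p - 1. d i * \<gamma> ^ i) \<and> (\<forall>i. d i \<in> Qp ordp)"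
    by (intro exI[of _ "\<lambda>i. a i + c i"]) (simp add: Qp_add sum.distrib algebra_simps)
qed

lemma coord_space_scale: "c \<in> Qp ordp \<Longrightarrow> x \<in> coord_space \<Longrightarrow> c * x \<in> coord_space"
  unfolding coord_space_def
proof clarify
  fix a :: "nat \<Rightarrow> 'a" assume "c \<in> Qp ordp" "\<forall>i. a i \<in> Qp ordp"
  then show "\<exists>d. c * (\<Sum>i<p - 1. a i * \<gamma> ^ i) = (\<Sum>i<p - 1. d i * \<gamma> ^ i) \<and> (\<forall>i. d i \<in> Qp ordp)"
    by (intro exI[of _ "\<lambda>i. c * a i"]) (simp add: Qp_mult sum_distrib_left algebra_simps)
qed

lemma Qp_subset_coord_space: "c \<in> Qp ordp \<Longrightarrow> c \<in> coord_space"
proof -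
  assume c: "c \<in> Qp ordp"
  have "(\<Sum>i<p - 1. (if i = 0 then c else 0) * \<gamma> ^ i) = (\<Sum>i<p - 1. if i = 0 then c else 0)"
    by (intro sum.cong) auto
  also have "\<dots> = c" using p_ge by simp
  finally show ?thesis using coord_spaceI[of "\<lambda>i. if i = 0 then c else 0"] c by simp
qed

text \<open>Multiplication by \<gamma> shifts the coordinates cyclically, the top one picking up the
  scalar \<gamma>^(p-1) from \<open>Qp ordp\<close>.\<close>

lemma coord_space_gamma: assumes "x \<in> coord_space" shows "\<gamma> * x \<in> coord_space"
proof -
  obtain a where a: "x = (\<Sum>i<p - 1. a i * \<gamma> ^ i)" "\<And>i. a i \<in> Qp ordp"
    using assms by (auto simp: coord_space_def)
  obtain n where n: "p - 1 = Suc n" using p_ge by (cases "p - 1") auto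
  have "\<gamma> * x = (\<Sum>i<Suc n. a i * \<gamma> ^ Suc i)"
    unfolding a n by (simp add: sum_distrib_left algebra_simps)
  also have "\<dots> = (\<Sum>i<n. a i * \<gamma> ^ Suc i) + a n * \<gamma> ^ (p - 1)"
    by (simp only: sum.lessThan_Suc n)
  also have "\<dots> = (\<Sum>i<Suc n. (case i of 0 \<Rightarrow> a n * \<gamma> ^ (p - 1) | Suc j \<Rightarrow> a j) * \<gamma> ^ i)"
    unfolding sum.lessThan_Suc_shift by simp
  also have "\<dots> \<in> coord_space"
    unfolding n[symmetric] using a gamma_power_in_Qp by (intro coord_spaceI) (auto simp: Qp_mult split: nat.split)
  finally show ?thesis .
qed

lemma coord_space_sum: "(\<And>i. i \<in> I \<Longrightarrow> f i \<in> coord_space) \<Longrightarrow> sum f I \<in> coord_space"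
  by (induction I rule: infinite_finite_induct) (auto intro: coord_space_add Qp_subset_coord_space)

lemma coord_space_mult: assumes "x \<in> coord_space" "y \<in> coord_space" shows "x * y \<in> coord_space"
proof -
  obtain a where a: "x = (\<Sum>i<p - 1. a i * \<gamma> ^ i)" "\<And>i. a i \<in> Qp ordp"
    using assms by (auto simp: coord_space_def)
  have "\<gamma> ^ i * y \<in> coord_space" for i
    by (induction i) (auto simp: assms mult.assoc intro: coord_space_gamma)
  then have "a i * (\<gamma> ^ i * y) \<in> coord_space" for i
    using a coord_space_scale by blast
  then show ?thesis
    unfolding a by (auto simp: sum_distrib_right mult.assoc intro: coord_space_sum)
qed

text \<open>An annihilating polynomial of \<open>x\<close> over \<open>Qp ordp\<close> with constant
  term \<open>a\<close> other than 0 gives \<open>1/x\<close> as \<open>-1/a\<close> times a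
  polynomial in \<open>x\<close>. The induction strips off factors \<open>X\<close> until the
  constant term is nonzero.\<close>

lemma coord_space_inverse: assumes "x \<in> coord_space" shows "inverse x \<in> coord_space"
proof (cases "x = 0")
  case True
  then show ?thesis using Qp_subset_coord_space[of 0] by simp
next
  case False
  obtain q where q: "q \<noteq> 0" "\<forall>i. coeff q i \<in> Qp ordp" "poly q x = 0"
    using algebraic_over_Qp by blast
  have poly_in: "poly r x \<in> coord_space" if "\<forall>i. coeff r i \<in> Qp ordp" for r
    using that
  proof (induction r)
    case (pCons a r)
    have "a \<in> Qp ordp" "\<forall>i. coeff r i \<in> Qp ordp"
      using pCons.prems by (metis coeff_pCons_0, metis coeff_pCons_Suc)
    then show ?case
      using pCons.IH assms coord_space_add Qp_subset_coord_space coord_space_mult by simp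
  qed (simp add: Qp_subset_coord_space)
  show ?thesis using q
  proof (induction q)
    case (pCons a r)
    have r: "\<forall>i. coeff r i \<in> Qp ordp" and a: "a \<in> Qp ordp"
      using pCons.prems by (metis coeff_pCons_Suc, metis coeff_pCons_0)
    show ?case
    proof (cases "a = 0")
      case True
      then show ?thesis using pCons r False by auto
    next
      case a0: False
      have "a + x * poly r x = 0" using pCons.prems by simp
      then have "x * poly r x = - a" by (metis add_eq_0_iff)
      then have "inverse x = inverse (- a) * poly r x"
        using False a0 by (simp add: field_simps)
      then show ?thesis
        using coord_space_scale[OF Qp_inverse[OF Qp_minus[OF a]] poly_in[OF r]] by simp
    qed
  qed simp
qed

lemma is_subfield_coord_space: "is_subfield coord_space"
  unfolding is_subfield_def
  using coord_space_scale[of "- 1"] Qp_minus[of 1]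
  by (auto intro: Qp_subset_coord_space coord_space_add coord_space_mult coord_space_inverse)

lemma gamma_in_Omega0: "\<gamma> \<in> Omega0 ordp \<gamma>"
  by (auto simp: Omega0_def)

lemma Qp_subset_Omega0: "Qp ordp \<subseteq> Omega0 ordp \<gamma>"
  by (auto simp: Omega0_def)

lemma is_subfield_Omega0: "is_subfield (Omega0 ordp \<gamma>)"
  by (auto simp: Omega0_def is_subfield_def)

lemma Omega0_add: "x \<in> Omega0 ordp \<gamma> \<Longrightarrow> y \<in> Omega0 ordp \<gamma> \<Longrightarrow> x + y \<in> Omega0 ordp \<gamma>"
  and Omega0_mult: "x \<in> Omega0 ordp \<gamma> \<Longrightarrow> y \<in> Omega0 ordp \<gamma> \<Longrightarrow> x * y \<in> Omega0 ordp \<gamma>"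
  and Omega0_minus: "x \<in> Omega0 ordp \<gamma> \<Longrightarrow> - x \<in> Omega0 ordp \<gamma>"
  and Omega0_inverse: "x \<in> Omega0 ordp \<gamma> \<Longrightarrow> inverse x \<in> Omega0 ordp \<gamma>"
  and Omega0_0 [simp]: "0 \<in> Omega0 ordp \<gamma>"
  and Omega0_1 [simp]: "1 \<in> Omega0 ordp \<gamma>"
  using is_subfield_Omega0 by (auto simp: is_subfield_def)

lemma Omega0_diff: "x \<in> Omega0 ordp \<gamma> \<Longrightarrow> y \<in> Omega0 ordp \<gamma> \<Longrightarrow> x - y \<in> Omega0 ordp \<gamma>"
  using Omega0_add[of x "- y"] Omega0_minus by simp

lemma Omega0_sum: "(\<And>i. i \<in> I \<Longrightarrow> f i \<in> Omega0 ordp \<gamma>) \<Longrightarrow> sum f I \<in> Omega0 ordp \<gamma>"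
  by (induction I rule: infinite_finite_induct) (auto intro: Omega0_add)

lemma Omega0_prod: "(\<And>i. i \<in> I \<Longrightarrow> f i \<in> Omega0 ordp \<gamma>) \<Longrightarrow> prod f I \<in> Omega0 ordp \<gamma>"
  by (induction I rule: infinite_finite_induct) (auto intro: Omega0_mult)

lemma Omega0_of_nat [simp]: "of_nat n \<in> Omega0 ordp \<gamma>"
  by (induction n) (auto intro: Omega0_add)

lemma Omega0_eq: "Omega0 ordp \<gamma> = coord_space"
proof
  have "\<gamma> \<in> coord_space" using coord_space_gamma[OF Qp_subset_coord_space[of 1]] by simp
  then show "Omega0 ordp \<gamma> \<subseteq> coord_space"
    using is_subfield_coord_space Qp_subset_coord_space unfolding Omega0_def by blast
next
  have "\<gamma> ^ i \<in> Omega0 ordp \<gamma>" for i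
    by (induction i) (auto intro: Omega0_mult gamma_in_Omega0)
  then show "coord_space \<subseteq> Omega0 ordp \<gamma>"
    using Qp_subset_Omega0 unfolding coord_space_def by (auto intro!: Omega0_sum Omega0_mult)
qed

text \<open>Valuations of \<open>\<rat>\<^sub>p\<close> are integers, hence the terms \<open>a i * \<gamma>^i\<close> have distinct valuations.\<close>

lemma vge_coord:
  assumes "\<And>i. a i \<in> Qp ordp" "vge (\<Sum>i<p - 1. a i * \<gamma> ^ i) M" "i < p - 1"
  shows "vge (a i) (M - 1)"
proof -
  have "vge (a i * \<gamma> ^ i) M"
  proof (rule vge_sum_distinct_val[OF _ _ assms(2)])
    fix i j assume ij: "i \<in> {..<p - 1}" "j \<in> {..<p - 1}" and nz: "a i * \<gamma> ^ i \<noteq> 0" "a j * \<gamma> ^ j \<noteq> 0"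
      and eq: "val (a i * \<gamma> ^ i) = val (a j * \<gamma> ^ j)"
    obtain m n where mn: "val (a i) = of_int m" "val (a j) = of_int n"
      using val_Qp_Ints assms(1) nz by (metis Ints_cases mult_eq_0_iff)
    have "of_int m + real i / (real p - 1) = of_int n + real j / (real p - 1)"
      using eq nz mn by (simp add: val_mult val_power)
    then have "of_int m * (real p - 1) + real i = of_int n * (real p - 1) + real j"
      using p_ge by (simp add: field_simps)
    then have "of_int (m * (int p - 1) + int i) = (of_int (n * (int p - 1) + int j) :: real)"
      by simp
    then have *: "m * (int p - 1) + int i = n * (int p - 1) + int j"
      using of_int_eq_iff by blast
    \<comment> \<open>Both indices lie below \<open>p - 1\<close>, so they are recovered as
      remainders modulo \<open>p - 1\<close>.\<close>
    have "int i = (m * (int p - 1) + int i) mod (int p - 1)"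
      using ij p_ge by simp
    also have "\<dots> = int j" unfolding * using ij p_ge by simp
    finally show "i = j" by simp
  qed (use assms in auto)
  \<comment> \<open>Division by \<open>\<gamma> ^ i\<close> accounts for the loss of 1 in the
    conclusion.\<close>
  moreover have "val (\<gamma> ^ i) \<le> 1"
    using assms(3) p_ge by (simp add: val_power field_simps)
  moreover have "val (a i * \<gamma> ^ i) = val (a i) + val (\<gamma> ^ i)" if "a i \<noteq> 0"
    using that by (simp add: val_mult)
  ultimately show ?thesis by (cases "a i = 0") (auto simp: vge_iff)
qed

text \<open>\<open>vge_coord\<close> loses only a constant, so a Cauchy sequence is Cauchy in each
  coordinate, and the coordinates converge in \<open>Qp ordp\<close>.\<close>

lemma Omega0_Cauchy_convergent:
  assumes s: "\<And>n::nat. s n \<in> Omega0 ordp \<gamma>"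
    and C: "\<And>M. \<exists>N. \<forall>i\<ge>N. \<forall>j\<ge>N. vge (s i - s j) M"
  shows "\<exists>x\<in>Omega0 ordp \<gamma>. \<forall>M. \<exists>N. \<forall>n\<ge>N. vge (x - s n) M"
proof -
  have "\<exists>a. s n = (\<Sum>i<p - 1. a i * \<gamma> ^ i) \<and> (\<forall>i. a i \<in> Qp ordp)" for n
    using s unfolding Omega0_eq coord_space_def by blast
  then obtain a where a: "\<And>n. s n = (\<Sum>i<p - 1. a n i * \<gamma> ^ i)" "\<And>n i. a n i \<in> Qp ordp" by metis
  have "\<exists>x\<in>Qp ordp. \<forall>M. \<exists>N. \<forall>n\<ge>N. vge (x - a n i) M" if i: "i < p - 1" for i
  proof -
    have "\<exists>N. \<forall>k\<ge>N. \<forall>l\<ge>N. vge (a k i - a l i) M" for M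
    proof -
      obtain N where N: "\<forall>k\<ge>N. \<forall>l\<ge>N. vge (s k - s l) (M + 1)" using C by blast
      have "vge (a k i - a l i) M" if "k \<ge> N" "l \<ge> N" for k l
      proof -
        have "vge (\<Sum>i<p - 1. (a k i - a l i) * \<gamma> ^ i) (M + 1)"
          using N that a by (simp add: algebra_simps sum_subtractf)
        from vge_coord[OF _ this i] show ?thesis using a by (simp add: Qp_diff)
      qed
      then show ?thesis by blast
    qed
    from Qp_Cauchy_convergent[of "\<lambda>n. a n i", OF a(2) this] show ?thesis by metis
  qed
  then obtain y where y: "\<And>i. i < p - 1 \<Longrightarrow> y i \<in> Qp ordp"
      "\<And>i M. i < p - 1 \<Longrightarrow> \<exists>N. \<forall>n\<ge>N. vge (y i - a n i) M"
    by metis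
  have "\<exists>N. \<forall>n\<ge>N. vge ((\<Sum>i<p - 1. y i * \<gamma> ^ i) - s n) M" for M
  proof -
    have "\<forall>i. \<exists>N. i < p - 1 \<longrightarrow> (\<forall>n\<ge>N. vge (y i - a n i) M)" using y(2) by blast
    from choice[OF this] obtain N
      where N: "\<And>i. i < p - 1 \<Longrightarrow> \<forall>n\<ge>N i. vge (y i - a n i) M" by blast
    have "vge ((\<Sum>i<p - 1. y i * \<gamma> ^ i) - s n) M" if n: "n \<ge> (\<Sum>i<p - 1. N i)" for n
    proof -
      have "vge (\<Sum>i<p - 1. (y i - a n i) * \<gamma> ^ i) M"
      proof (intro vge_sum)
        fix i assume i: "i \<in> {..<p - 1}"
        then have "N i \<le> (\<Sum>i<p - 1. N i)" by (intro member_le_sum) auto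
        then have "vge (y i - a n i) M" using N i n by simp
        moreover have "vge (\<gamma> ^ i) 0" using p_ge by (simp add: vge_iff val_power)
        ultimately show "vge ((y i - a n i) * \<gamma> ^ i) M" by (rule vge_mult_le) simp
      qed
      then show ?thesis by (simp add: a algebra_simps sum_subtractf)
    qed
    then show ?thesis by blast
  qed
  moreover have "(\<Sum>i<p - 1. y i * \<gamma> ^ i) \<in> Omega0 ordp \<gamma>"
  proof -
    have "(\<Sum>i<p - 1. y i * \<gamma> ^ i) = (\<Sum>i<p - 1. (if i < p - 1 then y i else 0) * \<gamma> ^ i)"
      by (intro sum.cong) auto
    then show ?thesis unfolding Omega0_eq using y(1) coord_spaceI[of "\<lambda>i. if i < p - 1 then y i else 0"] by simp
  qed
  ultimately show ?thesis by blast
qed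

end

section \<open>Estimates for the matrix \<open>H\<close>\<close>

definition tx_coeff :: "'a txseries \<Rightarrow> nat \<Rightarrow> nat \<Rightarrow> 'a" where
  "tx_coeff F i k = F k (int i - int k)"

text \<open>Since x^i y^k = t^k x^(i-k), such a series is a power series in x and y, and
  \<open>tx_coeff\<close> lists all its coefficients.\<close>

definition tx_supported :: "'a::zero txseries \<Rightarrow> bool" where
  "tx_supported F \<longleftrightarrow> (\<forall>k u. int k + u < 0 \<longrightarrow> F k u = 0)"

text \<open>\<open>G\<close> has to agree with a finite sum of monomials only where the support of
  \<open>F\<close> allows a contribution. So the infinite series \<open>W1\<close> and
  \<open>W2\<close> can be truncated separately for each coefficient of the product.\<close>

lemma tx_times_finite_sum:
  fixes F G :: "'a::field txseries"
  assumes "tx_supported F" "finite J"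
    and G: "\<And>i v. i \<le> k \<Longrightarrow> v \<le> u + int k - int i \<Longrightarrow> G i v = (\<Sum>j\<in>J. c j * tx_monom (a j) (r j) i v)"
  shows "(G \<otimes>\<^sub>t\<^sub>x F) k u = (\<Sum>j\<in>J. c j * (if a j \<le> k then F (k - a j) (u - r j) else 0))"
proof -
  have F0: "F (k - i) (u - v) = 0" if "i \<le> k" "\<not> v \<le> u + int k - int i" for i v
    using assms(1) that unfolding tx_supported_def by (simp add: of_nat_diff)
  have eq: "G i v * F (k - i) (u - v) = (\<Sum>j\<in>J. c j * (if a j = i \<and> r j = v then F (k - i) (u - v) else 0))"
    if "i \<le> k" for i v
  proof (cases "v \<le> u + int k - int i")
    case True
    show ?thesis unfolding G[OF that True] sum_distrib_right
      by (intro sum.cong) (auto simp: tx_monom_def)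
  qed (use F0 that in \<open>simp add: if_distrib cong: if_cong\<close>)
  have inner: "Sum_any (\<lambda>v. G i v * F (k - i) (u - v)) = (\<Sum>j\<in>J. c j * (if a j = i then F (k - i) (u - r j) else 0))"
    if "i \<le> k" for i
  proof -
    have "Sum_any (\<lambda>v. G i v * F (k - i) (u - v)) = (\<Sum>v\<in>r ` J. G i v * F (k - i) (u - v))"
    proof (rule Sum_any.expand_superset)
      show "{v. G i v * F (k - i) (u - v) \<noteq> 0} \<subseteq> r ` J"
        unfolding eq[OF that] by (auto elim!: sum.not_neutral_contains_not_neutral split: if_splits)
    qed (use assms in simp)
    also have "\<dots> = (\<Sum>j\<in>J. \<Sum>v\<in>r ` J. c j * (if a j = i \<and> r j = v then F (k - i) (u - v) else 0))"
      unfolding eq[OF that] by (rule sum.swap)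
    also have "\<dots> = (\<Sum>j\<in>J. c j * (if a j = i then F (k - i) (u - r j) else 0))"
    proof (rule sum.cong)
      fix j assume j: "j \<in> J"
      have "(\<Sum>v\<in>r ` J. c j * (if a j = i \<and> r j = v then F (k - i) (u - v) else 0))
          = (\<Sum>v\<in>r ` J. if v = r j then c j * (if a j = i then F (k - i) (u - r j) else 0) else 0)"
        by (intro sum.cong) auto
      then show "(\<Sum>v\<in>r ` J. c j * (if a j = i \<and> r j = v then F (k - i) (u - v) else 0))
          = c j * (if a j = i then F (k - i) (u - r j) else 0)"
        using j assms(2) by (simp add: sum.delta)
    qed simp
    finally show ?thesis .
  qed
  have "(G \<otimes>\<^sub>t\<^sub>x F) k u = (\<Sum>i\<le>k. \<Sum>j\<in>J. c j * (if a j = i then F (k - i) (u - r j) else 0))"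
    unfolding tx_times_def using inner by simp
  also have "\<dots> = (\<Sum>j\<in>J. \<Sum>i\<le>k. if i = a j then c j * F (k - a j) (u - r j) else 0)"
    by (subst sum.swap) (intro sum.cong, auto)
  also have "\<dots> = (\<Sum>j\<in>J. c j * (if a j \<le> k then F (k - a j) (u - r j) else 0))"
    by (intro sum.cong) (auto simp: sum.delta)
  finally show ?thesis .
qed

text \<open>Shifting by \<open>q\<close> cancels all but the last \<open>q\<close> terms. The
  truncated difference \<open>Suc i - q\<close> lets the window start at 0 while
  \<open>q > i\<close>.\<close>

lemma telescope_shift:
  fixes e :: "nat \<Rightarrow> 'a::ab_group_add"
  assumes "q \<ge> 1"
  shows "(\<Sum>i'\<le>i. (if q \<le> i' then e (i' - q) else 0) - e i') = - (\<Sum>i'\<in>{Suc i - q..i}. e i')"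
proof (induction i)
  case 0
  have "{Suc 0 - q..0} = {0}" using assms by auto
  then show ?case using assms by simp
next
  case (Suc i)
  show ?case
  proof (cases "q \<le> Suc i")
    case True
    have "{Suc i - q..Suc i} = insert (Suc i - q) {Suc (Suc i) - q..Suc i}" 
      using True assms by auto
    moreover have "Suc i - q \<notin> {Suc (Suc i) - q..Suc i}" using True by auto
    moreover have "{Suc i - q..Suc i} = insert (Suc i) {Suc i - q..i}" using assms by auto
    moreover have "Suc i \<notin> {Suc i - q..i}" by auto
    ultimately have "e (Suc i - q) + sum e {Suc (Suc i) - q..Suc i} = e (Suc i) + sum e {Suc i - q..i}"
      by (metis finite_atLeastAtMost sum.insert)
    then show ?thesis using Suc True by (simp add: algebra_simps)
  next
    case False
    then have "{Suc (Suc i) - q..Suc i} = {..Suc i}" "{Suc i - q..i} = {..i}" by auto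
    then show ?thesis using Suc False by simp
  qed
qed

locale kloosterman_setting = splitting_root p ordp \<gamma>
  for p and ordp :: "'a::{alg_closed_field, field_char_0} \<Rightarrow> ereal" and \<gamma> +
  fixes b b' \<epsilon> :: real
  assumes b_le: "b \<le> real p / (real p - 1)"
    and b_gt: "b > 1 / (real p - 1)"
    and b'_le: "b' \<le> b"
    and eps_def: "\<epsilon> = b - 1 / (real p - 1)"
begin

section \<open>Growth conditions and multiplication by \<open>W1\<close> and \<open>W2\<close> in
  coefficients\<close>

lemma eps_pos: "\<epsilon> > 0" using b_gt eps_def by simp

lemma b_hat: "real p / (real p - 1) = 1 + 1 / (real p - 1)"
  using p_ge by (simp add: field_simps)

text \<open>\<open>c i k\<close> is the coefficient of \<open>x^i y^k\<close>, where \<open>y = t/x\<close>.  This monomial equals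
  \<open>t^n t^(m(u)) x^u\<close> for \<open>n = min i k\<close> and \<open>u = i - k\<close>, so \<open>weight i k = 2 b' n + b |u|\<close>.\<close>

definition weight :: "nat \<Rightarrow> nat \<Rightarrow> real" where
  "weight i k = b * (real i + real k) - 2 * (b - b') * real (min i k)"

definition in_K :: "real \<Rightarrow> (nat \<Rightarrow> nat \<Rightarrow> 'a) \<Rightarrow> bool" where
  "in_K \<rho> c \<longleftrightarrow> (\<forall>i k. vge (c i k) (weight i k + \<rho>))"

text \<open>Because \<open>b' \<le> b\<close>, the weight in a fixed total degree never drops when
  \<open>min i k\<close> decreases, that is, away from the diagonal.\<close>

lemma weight_mono:
  assumes "min i k \<le> min i' k'" "b * (real i' + real k') + s \<le> b * (real i + real k) + s'"
  shows "weight i' k' + s \<le> weight i k + s'"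
proof -
  have "2 * (b - b') * real (min i k) \<le> 2 * (b - b') * real (min i' k')"
    using assms(1) b'_le by (intro mult_left_mono) auto
  then show ?thesis using assms(2) by (simp add: weight_def)
qed

lemma in_KD: "in_K \<rho> c \<Longrightarrow> \<sigma> \<le> \<rho> \<Longrightarrow> vge (c i k) (weight i k + \<sigma>)"
  unfolding in_K_def by (meson add_left_mono vge_mono)

lemma K_space_rho_supported: "F \<in> K_space_rho ordp \<gamma> b' b \<rho> \<Longrightarrow> tx_supported F"
  by (auto simp: K_space_rho_def K_series_def tx_supported_def m_exp_def)

lemma K_space_rho_in_K:
  assumes "F \<in> K_space_rho ordp \<gamma> b' b \<rho>"
  shows "in_K \<rho> (tx_coeff F)"
  unfolding in_K_def
proof (intro allI)
  fix i k
  obtain A where F: "F = K_series A"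
      and A: "\<And>n u. vge (A n u) (2 * b' * real n + b * \<bar>real_of_int u\<bar> + \<rho>)"
    using assms by (auto simp: K_space_rho_def vge_def)
  have m: "m_exp (int i - int k) = k - i" "k - (k - i) = min i k" by (auto simp: m_exp_def)
  have w: "weight i k = 2 * b' * real (min i k) + b * \<bar>real_of_int (int i - int k)\<bar>"
    by (auto simp: weight_def min_def algebra_simps)
  show "vge (tx_coeff F i k) (weight i k + \<rho>)"
    using A[of "min i k" "int i - int k"] m unfolding w by (simp add: tx_coeff_def F K_series_def)
qed

lemma less_power_p: "j < p ^ j"
  using p_ge by (intro power_gt_expt) auto

text \<open>Only \<open>j\<close> with \<open>p ^ j \<le> N\<close> contribute, and
  \<open>j < p ^ j\<close>, so the sum stops at \<open>N\<close>. The flag \<open>s\<close> tells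
  the monomials in x from those in y.\<close>

lemma W1_eq:
  assumes "k \<le> N" "u \<le> int N"
  shows "W1 p \<gamma> k u = (\<Sum>(j, s)\<in>{..N} \<times> UNIV. (if s then w_coef j else - w_coef j)
     * tx_monom (if s then 0 else p ^ j) (if s then int (p ^ j) else - int (p ^ j)) k u)"
proof -
  define g where "g j = w_coef j * (tx_monom 0 (int (p ^ j)) k u - tx_monom (p ^ j) (- int (p ^ j)) k u)" for j
  have g: "gamma_part p \<gamma> j * of_nat p ^ j * tx_subst_power (p ^ j) (x_dx f_tx) k u = g j" for j
  proof -
    define q where "q = p ^ j"
    have q: "q > 0" by (simp add: q_def)
    have 1: "q dvd k \<and> int q dvd u \<and> k div q = 0 \<and> u div int q = 1 \<longleftrightarrow> k = 0 \<and> u = int q"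
      using q by (auto elim!: dvdE)
    have 2: "q dvd k \<and> int q dvd u \<and> k div q = 1 \<and> u div int q = - 1 \<longleftrightarrow> k = q \<and> u = - int q"
      using q by (auto elim!: dvdE simp: zdiv_zminus1_eq_if)
    have "tx_subst_power q (x_dx f_tx) k u =
        (if q dvd k \<and> int q dvd u \<and> k div q = 0 \<and> u div int q = 1 then 1 else 0) -
        (if q dvd k \<and> int q dvd u \<and> k div q = 1 \<and> u div int q = - 1 then 1 else (0::'a))"
      by (auto simp: tx_subst_power_def x_dx_def f_tx_def tx_plus_def tx_monom_def)
    then show ?thesis
      unfolding 1 2 g_def w_coef_def q_def[symmetric] by (simp add: tx_monom_def)
  qed
  have "W1 p \<gamma> k u = sum g {..N}"
    unfolding W1_def g
  proof (rule Sum_any.expand_superset)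
    show "{a. g a \<noteq> 0} \<subseteq> {..N}"
    proof
      fix j assume "j \<in> {a. g a \<noteq> 0}"
      then have "u = int (p ^ j) \<or> k = p ^ j" by (auto simp: g_def tx_monom_def split: if_splits)
      then have "p ^ j \<le> N" using assms by linarith
      then show "j \<in> {..N}" using less_power_p[of j] by simp
    qed
  qed simp
  also have "\<dots> = (\<Sum>j\<le>N. \<Sum>s\<in>UNIV. (if s then w_coef j else - w_coef j)
     * tx_monom (if s then 0 else p ^ j) (if s then int (p ^ j) else - int (p ^ j)) k u)"
    by (intro sum.cong) (auto simp: g_def UNIV_bool algebra_simps)
  also have "\<dots> = (\<Sum>(j, s)\<in>{..N} \<times> UNIV. (if s then w_coef j else - w_coef j)
     * tx_monom (if s then 0 else p ^ j) (if s then int (p ^ j) else - int (p ^ j)) k u)"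
    by (simp only: sum.cartesian_product)
  finally show ?thesis .
qed

lemma W2_eq:
  assumes "k \<le> N"
  shows "W2 p \<gamma> k u = (\<Sum>j\<le>N. w_coef j * tx_monom (p ^ j) (- int (p ^ j)) k u)"
  unfolding W2_def w_coef_def
proof (rule Sum_any.expand_superset)
  show "{a. gamma_part p \<gamma> a * of_nat p ^ a * tx_monom (p ^ a) (- int (p ^ a)) k u \<noteq> 0} \<subseteq> {..N}"
  proof
    fix j assume "j \<in> {a. gamma_part p \<gamma> a * of_nat p ^ a * tx_monom (p ^ a) (- int (p ^ a)) k u \<noteq> 0}"
    then have "k = p ^ j" by (auto simp: tx_monom_def split: if_splits)
    then show "j \<in> {..N}" using less_power_p[of j] assms by simp
  qed
qed simp

text \<open>Multiplication by the sum of all w_j (x^(p^j) - y^(p^j)); as \<open>j < p ^ j\<close>,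
  terms with \<open>j > i + k\<close> vanish.\<close>

definition W1_mult :: "(nat \<Rightarrow> nat \<Rightarrow> 'a) \<Rightarrow> nat \<Rightarrow> nat \<Rightarrow> 'a" where
  "W1_mult x i k = (\<Sum>j\<le>i + k. w_coef j *
     ((if p ^ j \<le> i then x (i - p ^ j) k else 0) - (if p ^ j \<le> k then x i (k - p ^ j) else 0)))"

lemma tx_coeff_W1_times:
  assumes "tx_supported F"
  shows "tx_coeff (W1 p \<gamma> \<otimes>\<^sub>t\<^sub>x F) i k = W1_mult (tx_coeff F) i k"
proof -
  let ?a = "\<lambda>(j, s). if s then 0 else p ^ j"
  let ?r = "\<lambda>(j, s). if s then int (p ^ j) else - int (p ^ j)"
  let ?c = "\<lambda>(j, s). if s then w_coef j else - w_coef j"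
  have "tx_coeff (W1 p \<gamma> \<otimes>\<^sub>t\<^sub>x F) i k = (\<Sum>js\<in>{..i + k} \<times> UNIV. ?c js *
      (if ?a js \<le> k then F (k - ?a js) (int i - int k - ?r js) else 0))"
    unfolding tx_coeff_def
  proof (rule tx_times_finite_sum[OF assms])
    fix i' v assume "i' \<le> k" "v \<le> int i - int k + int k - int i'"
    then show "W1 p \<gamma> i' v = (\<Sum>js\<in>{..i + k} \<times> UNIV. ?c js * tx_monom (?a js) (?r js) i' v)"
      by (subst W1_eq[of _ "i + k"]) (auto simp: case_prod_beta)
  qed simp
  also have "\<dots> = (\<Sum>j\<le>i + k. \<Sum>s\<in>UNIV. ?c (j, s) *
      (if ?a (j, s) \<le> k then F (k - ?a (j, s)) (int i - int k - ?r (j, s)) else 0))"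
    unfolding sum.cartesian_product by (intro sum.cong) auto
  also have "\<dots> = W1_mult (tx_coeff F) i k"
    unfolding W1_mult_def
  proof (rule sum.cong)
    fix j
    define q where "q = p ^ j"
    have "F k (int i - int k - int q) = (if q \<le> i then tx_coeff F (i - q) k else 0)"
      using assms unfolding tx_supported_def tx_coeff_def by (auto simp: of_nat_diff algebra_simps)
    moreover have "(if q \<le> k then F (k - q) (int i - int k + int q) else 0) = (if q \<le> k then tx_coeff F i (k - q) else 0)"
      unfolding tx_coeff_def by (auto simp: of_nat_diff algebra_simps)
    moreover have "(\<Sum>s\<in>UNIV. ?c (j, s) *
        (if ?a (j, s) \<le> k then F (k - ?a (j, s)) (int i - int k - ?r (j, s)) else 0))
      = w_coef j * (F k (int i - int k - int q) - (if q \<le> k then F (k - q) (int i - int k + int q) else 0))"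
      by (simp add: UNIV_bool q_def algebra_simps)
    ultimately show "(\<Sum>s\<in>UNIV. ?c (j, s) *
      (if ?a (j, s) \<le> k then F (k - ?a (j, s)) (int i - int k - ?r (j, s)) else 0)) = w_coef j *
     ((if p ^ j \<le> i then tx_coeff F (i - p ^ j) k else 0) - (if p ^ j \<le> k then tx_coeff F i (k - p ^ j) else 0))"
      unfolding q_def[symmetric] by simp
  qed simp
  finally show ?thesis .
qed

lemma tx_coeff_W2_times:
  assumes "tx_supported F"
  shows "tx_coeff (W2 p \<gamma> \<otimes>\<^sub>t\<^sub>x F) i k = (\<Sum>j\<le>k. w_coef j * (if p ^ j \<le> k then tx_coeff F i (k - p ^ j) else 0))"
proof -
  have "tx_coeff (W2 p \<gamma> \<otimes>\<^sub>t\<^sub>x F) i k = (\<Sum>j\<le>k. w_coef j *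
      (if p ^ j \<le> k then F (k - p ^ j) (int i - int k - - int (p ^ j)) else 0))"
    unfolding tx_coeff_def by (rule tx_times_finite_sum[OF assms]) (auto intro!: W2_eq simp del: of_nat_power)
  then show ?thesis unfolding tx_coeff_def by (auto simp: of_nat_diff algebra_simps intro!: sum.cong)
qed

lemma tx_coeff_fps_times:
  assumes "tx_supported F"
  shows "tx_coeff (tx_of_fps h \<otimes>\<^sub>t\<^sub>x F) i k = (\<Sum>j\<le>k. fps_nth h j * F (k - j) (int i - int k))"
proof -
  have "tx_coeff (tx_of_fps h \<otimes>\<^sub>t\<^sub>x F) i k = (\<Sum>j\<le>k. fps_nth h j *
      (if j \<le> k then F (k - j) (int i - int k - 0) else 0))"
    unfolding tx_coeff_def
  proof (rule tx_times_finite_sum[OF assms])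
    fix i' v assume "i' \<le> k"
    then show "tx_of_fps h i' v = (\<Sum>j\<le>k. fps_nth h j * tx_monom j 0 i' v)"
      by (simp add: tx_of_fps_def tx_monom_def if_distrib[of "\<lambda>x. _ * x"] sum.delta' cong: if_cong)
  qed simp
  then show ?thesis by (auto intro!: sum.cong)
qed

section \<open>Summation along antidiagonals\<close>

definition V_coeff :: "(nat \<Rightarrow> 'a) \<Rightarrow> (nat \<Rightarrow> 'a) \<Rightarrow> nat \<Rightarrow> nat \<Rightarrow> 'a" where
  "V_coeff h0 h1 i k = (if k = i then h0 i else if k = Suc i then h1 i else 0)"

text \<open>\<open>V_coeff h0 h1\<close> has one monomial in each total degree \<open>d\<close>, and multiplication by
  \<open>x^q - y^q\<close> telescopes along the antidiagonal of degree \<open>d\<close>.\<close>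

lemma sum_W1_mult_antidiagonal:
  assumes "i \<le> d"
  shows "(\<Sum>i'\<le>i. W1_mult x i' (d - i')) =
    - (\<Sum>j\<le>d. w_coef j * (\<Sum>i'\<in>{Suc i - p ^ j..i}. if i' + p ^ j \<le> d then x i' (d - p ^ j - i') else 0))"
proof -
  have "(\<Sum>i'\<le>i. W1_mult x i' (d - i')) = (\<Sum>i'\<le>i. \<Sum>j\<le>d. w_coef j *
     ((if p ^ j \<le> i' then x (i' - p ^ j) (d - i') else 0) - (if p ^ j \<le> d - i' then x i' (d - i' - p ^ j) else 0)))"
    using assms by (intro sum.cong) (auto simp: W1_mult_def)
  also have "\<dots> = (\<Sum>j\<le>d. w_coef j * (\<Sum>i'\<le>i.
     (if p ^ j \<le> i' then x (i' - p ^ j) (d - i') else 0) - (if p ^ j \<le> d - i' then x i' (d - i' - p ^ j) else 0)))"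
    by (subst sum.swap) (simp add: sum_distrib_left)
  also have "\<dots> = (\<Sum>j\<le>d. w_coef j * - (\<Sum>i'\<in>{Suc i - p ^ j..i}. if i' + p ^ j \<le> d then x i' (d - p ^ j - i') else 0))"
  proof (intro sum.cong arg_cong2[of _ _ _ _ "(*)"] refl)
    fix j
    define q where "q = p ^ j"
    \<comment> \<open>On the antidiagonal of degree \<open>d\<close>, the factor y^q produces the
      sequence \<open>e\<close> and the factor x^q its shift by \<open>q\<close>.\<close>
    define e where "e i' = (if i' + q \<le> d then x i' (d - q - i') else 0)" for i'
    have "(\<Sum>i'\<le>i. (if q \<le> i' then x (i' - q) (d - i') else 0) - (if q \<le> d - i' then x i' (d - i' - q) else 0))
        = (\<Sum>i'\<le>i. (if q \<le> i' then e (i' - q) else 0) - e i')"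
      using assms by (intro sum.cong) (auto simp: e_def diff_commute add.commute)
    also have "\<dots> = - (\<Sum>i'\<in>{Suc i - q..i}. e i')"
      by (rule telescope_shift) (simp add: q_def Suc_leI)
    finally show "(\<Sum>i'\<le>i. (if p ^ j \<le> i' then x (i' - p ^ j) (d - i') else 0) - (if p ^ j \<le> d - i' then x i' (d - i' - p ^ j) else 0))
        = - (\<Sum>i'\<in>{Suc i - p ^ j..i}. if i' + p ^ j \<le> d then x i' (d - p ^ j - i') else 0)"
      unfolding q_def e_def .
  qed
  finally show ?thesis by (simp add: sum_negf)
qed

text \<open>For \<open>i = d\<close> every index \<open>i'\<close> of the window has
  \<open>i' + p ^ j > d\<close>, so all entries are cut off. This is the substitution x = y, under
  which \<open>W1\<close> vanishes.\<close>

lemma sum_W1_mult_antidiagonal_full: "(\<Sum>i\<le>d. W1_mult x i (d - i)) = 0"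
  unfolding sum_W1_mult_antidiagonal[OF order_refl]
  by ((auto intro!: sum.neutral), linarith)

lemma sum_V_coeff:
  assumes "i \<le> d"
  shows "(\<Sum>i'\<le>i. V_coeff h0 h1 i' (d - i')) =
    (if d div 2 \<le> i then (if even d then h0 (d div 2) else h1 (d div 2)) else 0)"
proof -
  have "V_coeff h0 h1 i' (d - i') = (if i' = d div 2 then (if even d then h0 (d div 2) else h1 (d div 2)) else 0)"
    if "i' \<le> i" for i'
    using that assms unfolding V_coeff_def by (auto elim!: evenE oddE) presburger+
  then have "(\<Sum>i'\<le>i. V_coeff h0 h1 i' (d - i')) =
      (\<Sum>i'\<le>i. if i' = d div 2 then (if even d then h0 (d div 2) else h1 (d div 2)) else 0)"
    by (intro sum.cong) auto
  then show ?thesis by (simp add: sum.delta)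
qed

lemma antidiagonal_sum_eq:
  assumes "\<And>i k. R i k = V_coeff h0 h1 i k + W1_mult x i k"
  shows "(\<Sum>i\<le>d. R i (d - i)) = (if even d then h0 (d div 2) else h1 (d div 2))"
  unfolding assms sum.distrib sum_W1_mult_antidiagonal_full sum_V_coeff[OF order_refl] by simp

text \<open>Before the middle of the antidiagonal the difference is a head, from the middle on it is
  minus a tail. So for every entry that occurs the minimum of its two indices is at most
  \<open>min i (d - 1 - i)\<close>, and its total degree, larger by one, yields the gain
  \<open>b\<close>.\<close>

lemma vge_partial_antidiagonal:
  assumes R: "in_K \<rho> R" and i: "i < d"
  shows "vge ((\<Sum>i'\<le>i. R i' (d - i')) - (if d div 2 \<le> i then \<Sum>i'\<le>d. R i' (d - i') else 0))
     (weight i (d - 1 - i) + (b + \<rho>))"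
proof (cases "d div 2 \<le> i")
  case True
  have "{..d} = {..i} \<union> {Suc i..d}" using i by auto
  then have "(\<Sum>i'\<le>d. R i' (d - i')) = (\<Sum>i'\<le>i. R i' (d - i')) + (\<Sum>i'\<in>{Suc i..d}. R i' (d - i'))"
    by (simp only:) (rule sum.union_disjoint, auto)
  moreover have "vge (\<Sum>i'\<in>{Suc i..d}. R i' (d - i')) (weight i (d - 1 - i) + (b + \<rho>))"
  proof (intro vge_sum)
    fix i' assume i': "i' \<in> {Suc i..d}"
    have "weight i (d - 1 - i) + (b + \<rho>) \<le> weight i' (d - i') + \<rho>"
      using i i' True by (intro weight_mono) (auto simp: of_nat_diff algebra_simps)
    then show "vge (R i' (d - i')) (weight i (d - 1 - i) + (b + \<rho>))"
      using R vge_mono unfolding in_K_def by blast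
  qed
  ultimately show ?thesis using True by simp
next
  case False
  have "vge (\<Sum>i'\<le>i. R i' (d - i')) (weight i (d - 1 - i) + (b + \<rho>))"
  proof (intro vge_sum)
    fix i' assume i': "i' \<in> {..i}"
    have "weight i (d - 1 - i) + (b + \<rho>) \<le> weight i' (d - i') + \<rho>"
      using i i' False by (intro weight_mono) (auto simp: of_nat_diff algebra_simps)
    then show "vge (R i' (d - i')) (weight i (d - 1 - i) + (b + \<rho>))"
      using R vge_mono unfolding in_K_def by blast
  qed
  then show ?thesis using False by simp
qed

section \<open>A priori bounds for solutions\<close>

lemma w_coef_weight: "q \<ge> 1 \<Longrightarrow> b * q \<le> real p / (real p - 1) * q - 1 + \<epsilon>" for q :: real
proof -
  assume "q \<ge> 1"
  \<comment> \<open>By \<open>b_hat\<close> this is the claim. It says that the terms of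
    \<open>W1\<close> of degree q > 1 are no worse than the term of degree 1, where equality
    holds.\<close>
  then have "(real p / (real p - 1) - b) * (q - 1) \<ge> 0" using b_le by simp
  then show ?thesis unfolding eps_def by (simp add: algebra_simps b_hat diff_divide_distrib)
qed

text \<open>Induction on the total degree \<open>n\<close>. In degree \<open>n + 1\<close> of the
  equation the term \<open>j = 0\<close> of \<open>W1\<close> isolates
  \<open>\<gamma> * x i k\<close>, while the terms with \<open>j \<ge> 1\<close> only involve
  entries of \<open>x\<close> of smaller degree.\<close>

lemma W1_apriori:
  assumes eq: "\<And>i k. R i k = V_coeff h0 h1 i k + W1_mult x i k" and R: "in_K \<rho> R"
  shows "in_K (\<rho> + \<epsilon>) x"
proof -
  have "\<forall>i k. i + k = n \<longrightarrow> vge (x i k) (weight i k + (\<rho> + \<epsilon>))" for n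
  proof (induction n rule: less_induct)
    case (less n)
    show ?case
    proof (intro allI impI)
      fix i k assume n: "i + k = n"
      define d where "d = Suc n"
      have i: "i < d" and k: "k = d - 1 - i" using n by (auto simp: d_def)
      define E where "E j = (\<Sum>i'\<in>{Suc i - p ^ j..i}. if i' + p ^ j \<le> d then x i' (d - p ^ j - i') else 0)" for j
      let ?w = "weight i k + (b + \<rho>)"
      define P where "P = (\<Sum>i'\<le>i. R i' (d - i')) - (if d div 2 \<le> i then \<Sum>i'\<le>d. R i' (d - i') else 0)"
      have "(\<Sum>i'\<le>i. R i' (d - i')) = (if d div 2 \<le> i then \<Sum>i'\<le>d. R i' (d - i') else 0) - (\<Sum>j\<le>d. w_coef j * E j)"
        unfolding antidiagonal_sum_eq[OF eq]
        unfolding eq sum.distrib using i by (simp add: sum_V_coeff sum_W1_mult_antidiagonal E_def)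
      then have "P = - (\<Sum>j\<le>d. w_coef j * E j)" by (simp add: P_def)
      also have "(\<Sum>j\<le>d. w_coef j * E j) = \<gamma> * E 0 + (\<Sum>j\<in>{1..d}. w_coef j * E j)"
        by (simp add: atMost_atLeast0 sum.atLeast_Suc_atMost)
      \<comment> \<open>The window for \<open>p ^ 0 = 1\<close> consists of \<open>i\<close>
        alone.\<close>
      also have "E 0 = x i k" using i k by (simp add: E_def)
      finally have gx: "\<gamma> * x i k = - P - (\<Sum>j\<in>{1..d}. w_coef j * E j)" by simp
      have "vge P ?w" unfolding P_def k by (rule vge_partial_antidiagonal[OF R i])
      moreover have "vge (\<Sum>j\<in>{1..d}. w_coef j * E j) ?w"
      proof (intro vge_sum)
        fix j assume j: "j \<in> {1..d}"
        define q where "q = p ^ j"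
        have q2: "q \<ge> 2" using less_power_p[of j] j by (simp add: q_def)
        \<comment> \<open>The bound on \<open>E j\<close> that, together with
          \<open>vge_w_coef\<close>, brings the product up to \<open>?w\<close>.\<close>
        define s where "s = ?w - (real p / (real p - 1) * real q - 1)"
        have "vge (E j) s" unfolding E_def q_def[symmetric]
        proof (intro vge_sum)
          fix i' assume i': "i' \<in> {Suc i - q..i}"
          show "vge (if i' + q \<le> d then x i' (d - q - i') else 0) s"
          proof (cases "i' + q \<le> d")
            case True
            have "i' + (d - q - i') = d - q" "d - q < n" using True q2 by (auto simp: d_def)
            then have *: "vge (x i' (d - q - i')) (weight i' (d - q - i') + (\<rho> + \<epsilon>))"
              using less by blast
            have "weight i k + (b + \<rho> - (real p / (real p - 1) * real q - 1)) \<le> weight i' (d - q - i') + (\<rho> + \<epsilon>)"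
            proof (rule weight_mono)
              show "min i' (d - q - i') \<le> min i k" using i' True k by auto
              have deg: "real i + real k = real d - 1" "real i' + real (d - q - i') = real d - real q"
                using n True by (auto simp: d_def of_nat_diff)
              show "b * (real i + real k) + (b + \<rho> - (real p / (real p - 1) * real q - 1))
                  \<le> b * (real i' + real (d - q - i')) + (\<rho> + \<epsilon>)"
                unfolding deg using w_coef_weight[of "real q"] q2 by (simp add: algebra_simps)
            qed
            then show ?thesis using True vge_mono[OF *] by (simp add: s_def)
          qed simp
        qed
        then show "vge (w_coef j * E j) ?w"
          by (rule vge_mult_le[OF vge_w_coef]) (simp add: s_def q_def)
      qed
      ultimately have "vge (\<gamma> * x i k) ?w" unfolding gx by (intro vge_diff) auto
      \<comment> \<open>Division by \<gamma> turns the gain \<open>b\<close> into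
        \<epsilon>.\<close>
      then show "vge (x i k) (weight i k + (\<rho> + \<epsilon>))"
        by (cases "x i k = 0") (auto simp: vge_iff val_mult eps_def)
    qed
  qed
  then show ?thesis by (simp add: in_K_def)
qed

text \<open>Moving the Euler term to the left side costs no valuation, so each use of
  \<open>W1_apriori\<close> improves the known bound for \<open>x\<close> by \<epsilon> until
  \<open>\<sigma> + \<epsilon>\<close> is reached.\<close>

lemma D_apriori:
  assumes eq: "\<And>i k. R i k = V_coeff h0 h1 i k + (of_int (int i - int k) * x i k + W1_mult x i k)"
    and R: "in_K \<sigma> R" and x: "in_K \<rho> x"
  shows "in_K (\<sigma> + \<epsilon>) x"
proof -
  have "in_K (min (\<sigma> + \<epsilon>) (\<rho> + real n * \<epsilon>)) x" for n
  proof (induction n)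
    case 0
    show ?case unfolding in_K_def by (intro allI in_KD[OF x]) simp
  next
    case (Suc n)
    have "in_K (min \<sigma> (\<rho> + real n * \<epsilon>)) (\<lambda>i k. R i k - of_int (int i - int k) * x i k)"
      unfolding in_K_def
    proof (intro allI vge_diff vge_of_int_mult)
      fix i k
      show "vge (R i k) (weight i k + min \<sigma> (\<rho> + real n * \<epsilon>))"
        by (rule in_KD[OF R]) simp
      show "vge (x i k) (weight i k + min \<sigma> (\<rho> + real n * \<epsilon>))"
        by (rule in_KD[OF Suc]) (use eps_pos in auto)
    qed
    from W1_apriori[OF _ this, of h0 h1 x]
    have "in_K (min \<sigma> (\<rho> + real n * \<epsilon>) + \<epsilon>) x" using eq by simp
    moreover have "min \<sigma> (\<rho> + real n * \<epsilon>) + \<epsilon> = min (\<sigma> + \<epsilon>) (\<rho> + real (Suc n) * \<epsilon>)"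
      by (auto simp: min_def algebra_simps)
    ultimately show ?case by simp
  qed
  moreover obtain n where "(\<sigma> + \<epsilon> - \<rho>) / \<epsilon> < real n" using reals_Archimedean2 by blast
  then have "min (\<sigma> + \<epsilon>) (\<rho> + real n * \<epsilon>) = \<sigma> + \<epsilon>" using eps_pos by (simp add: field_simps)
  ultimately show ?thesis by metis
qed

text \<open>The least weight in degree \<open>2 * n\<close> is attained at \<open>(n, n)\<close>, in
  degree \<open>2 * n + 1\<close> at \<open>(n, n + 1)\<close>.\<close>

lemma vge_antidiagonal_sum:
  assumes "in_K \<rho> c"
  shows "vge (\<Sum>i\<le>2 * n. c i (2 * n - i)) (2 * b' * real n + \<rho>)"
    and "vge (\<Sum>i\<le>Suc (2 * n). c i (Suc (2 * n) - i)) (2 * b' * real n + b + \<rho>)"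
proof -
  have "vge (c i k) (2 * b' * real n + \<rho>)" if "i + k = 2 * n" for i k
  proof -
    have deg: "real i + real k = real n + real n" using that by linarith
    have "weight n n + \<rho> \<le> weight i k + \<rho>"
      by (rule weight_mono) (use that in \<open>auto simp only: deg\<close>, linarith?)
    moreover have "weight n n = 2 * b' * real n" by (simp add: weight_def algebra_simps)
    ultimately show ?thesis using assms vge_mono unfolding in_K_def by metis
  qed
  then show "vge (\<Sum>i\<le>2 * n. c i (2 * n - i)) (2 * b' * real n + \<rho>)"
    by (intro vge_sum) auto
  have "vge (c i k) (2 * b' * real n + b + \<rho>)" if "i + k = Suc (2 * n)" for i k
  proof -
    have deg: "real i + real k = real n + real (Suc n)" using that by linarith
    have "weight n (Suc n) + \<rho> \<le> weight i k + \<rho>"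
      by (rule weight_mono) (use that in \<open>auto simp only: deg\<close>, linarith?)
    moreover have "weight n (Suc n) = 2 * b' * real n + b" by (simp add: weight_def algebra_simps)
    ultimately show ?thesis using assms vge_mono unfolding in_K_def by metis
  qed
  then show "vge (\<Sum>i\<le>Suc (2 * n). c i (Suc (2 * n) - i)) (2 * b' * real n + b + \<rho>)"
    by (intro vge_sum) auto
qed

section \<open>Reduction of series in y modulo the image of \<open>D_hat\<close>\<close>

lemma prime_power_odd: "odd (p ^ j)"
  using prime_p p_ge prime_odd_nat[of p] by simp

text \<open>A series in y alone; \<open>del_hat\<close> maps both basis elements to such
  series.\<close>

definition y_series :: "(nat \<Rightarrow> 'a) \<Rightarrow> nat \<Rightarrow> nat \<Rightarrow> 'a" where
  "y_series c i k = (if i = 0 then c k else 0)"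

lemma sum_y_series: "(\<Sum>i\<le>d. y_series c i (d - i)) = c d"
proof -
  have "(\<Sum>i\<le>d. y_series c i (d - i)) = (\<Sum>i\<le>d. if i = 0 then c d else 0)"
    by (intro sum.cong) (auto simp: y_series_def)
  then show ?thesis by simp
qed

lemma in_K_y_series: "(\<And>k. vge (c k) (b * real k + \<rho>)) \<Longrightarrow> in_K \<rho> (y_series c)"
  by (auto simp: in_K_def y_series_def weight_def)

text \<open>The hypothesis \<open>eq\<close> says \<open>\<Sum> c\<^sub>k y^k = h0 + h1 t/x + D_hat x\<close> in coefficients.  Summing over
  antidiagonals determines \<open>h0\<close> and \<open>h1\<close> up to a contribution of \<open>x\<close>, which gains \<open>\<epsilon>\<close>.\<close>

lemma reduction_estimate:
  assumes eq: "\<And>i k. y_series c i k = V_coeff h0 h1 i k + (of_int (int i - int k) * x i k + W1_mult x i k)"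
    and c: "\<And>k. vge (c k) (b * real k + \<sigma>)" and x: "in_K \<rho> x"
  shows "vge (h0 n - c (2 * n)) (2 * b' * real n + \<sigma> + \<epsilon>)"
    and "vge (h1 n - c (Suc (2 * n))) (2 * b' * real n + b + \<sigma> + \<epsilon>)"
    and "h0 0 = c 0"
proof -
  have x': "in_K (\<sigma> + \<epsilon>) x" by (rule D_apriori[OF eq in_K_y_series[OF c] x])
  define z where "z i k = of_int (int i - int k) * x i k" for i k
  have z: "in_K (\<sigma> + \<epsilon>) z"
    using x' unfolding in_K_def z_def by (intro allI vge_of_int_mult) auto
  have "c d - (\<Sum>i\<le>d. z i (d - i)) = (if even d then h0 (d div 2) else h1 (d div 2))" for d
  proof -
    have "(\<Sum>i\<le>d. y_series c i (d - i) - z i (d - i)) = (if even d then h0 (d div 2) else h1 (d div 2))"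
      by (rule antidiagonal_sum_eq[where x = x]) (simp add: eq z_def)
    then show ?thesis by (simp only: sum_subtractf sum_y_series)
  qed
  \<comment> \<open>In degree 0 the Euler factor \<open>i - k\<close> is 0, which makes the constant
    term exact.\<close>
  from this[of "2 * n"] this[of "Suc (2 * n)"] this[of 0]
  have "h0 n - c (2 * n) = - (\<Sum>i\<le>2 * n. z i (2 * n - i))"
      "h1 n - c (Suc (2 * n)) = - (\<Sum>i\<le>Suc (2 * n). z i (Suc (2 * n) - i))"
      "h0 0 = c 0"
    by (simp_all add: algebra_simps z_def del: sum.atMost_Suc)
  then show "vge (h0 n - c (2 * n)) (2 * b' * real n + \<sigma> + \<epsilon>)"
    "vge (h1 n - c (Suc (2 * n))) (2 * b' * real n + b + \<sigma> + \<epsilon>)" "h0 0 = c 0"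
    using vge_antidiagonal_sum[OF z, of n] by (simp_all add: add.assoc del: sum.atMost_Suc)
qed

text \<open>The coefficient of y^k in \<open>W2\<close>; \<open>j \<le> k\<close> suffices because
  \<open>j < p ^ j\<close>.\<close>

definition W_coeff :: "nat \<Rightarrow> 'a" where
  "W_coeff k = (\<Sum>j\<le>k. w_coef j * (if k = p ^ j then 1 else 0))"

lemma vge_W_coeff: "vge (W_coeff k) (real p / (real p - 1) * real k - 1)"
  unfolding W_coeff_def using vge_w_coef by (intro vge_sum) auto

lemma W_coeff_even [simp]: assumes "even k" shows "W_coeff k = 0"
proof -
  have "k \<noteq> p ^ j" for j using assms prime_power_odd by metis
  then show ?thesis by (simp add: W_coeff_def)
qed

lemma W_coeff_1 [simp]: "W_coeff (Suc 0) = \<gamma>"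
  using p_ge by (simp add: W_coeff_def)

section \<open>The congruences defining \<open>H\<close> in coefficients\<close>

lemma tx_supported_monom: "int a + r \<ge> 0 \<Longrightarrow> tx_supported (tx_monom a r)"
  by (auto simp: tx_supported_def tx_monom_def)

lemma tx_supported_gamma: "tx_supported (gamma_t_over_x \<gamma>)"
  by (auto simp: tx_supported_def tx_monom_def gamma_t_over_x_def tx_scale_def)

lemma tx_coeff_D_hat:
  "tx_supported F \<Longrightarrow> tx_coeff (D_hat p \<gamma> F) i k
     = of_int (int i - int k) * tx_coeff F i k + W1_mult (tx_coeff F) i k"
  using tx_coeff_W1_times[of F i k] by (simp add: D_hat_def tx_plus_def x_dx_def tx_coeff_def)

text \<open>Since t = x y, a series in t lies on the diagonal \<open>k = i\<close>, and its product
  with t/x = y on \<open>k = Suc i\<close>.\<close>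

lemma tx_coeff_V:
  "tx_coeff (tx_of_fps h0 \<oplus>\<^sub>t\<^sub>x tx_of_fps h1 \<otimes>\<^sub>t\<^sub>x gamma_t_over_x \<gamma>) i k
     = V_coeff (fps_nth h0) (\<lambda>n. \<gamma> * fps_nth h1 n) i k"
proof -
  have "(\<Sum>j\<le>k. fps_nth h1 j * gamma_t_over_x \<gamma> (k - j) (int i - int k)) =
      (\<Sum>j\<le>k. if j = i then (if k = Suc i then \<gamma> * fps_nth h1 i else 0) else 0)"
    by (intro sum.cong) (auto simp: gamma_t_over_x_def tx_scale_def tx_monom_def)
  also have "\<dots> = (if k = Suc i then \<gamma> * fps_nth h1 i else 0)" by (simp add: sum.delta)
  finally have "tx_coeff (tx_of_fps h1 \<otimes>\<^sub>t\<^sub>x gamma_t_over_x \<gamma>) i k = (if k = Suc i then \<gamma> * fps_nth h1 i else 0)"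
    using tx_coeff_fps_times[OF tx_supported_gamma] by simp
  moreover have "tx_coeff (tx_of_fps h0) i k = (if k = i then fps_nth h0 i else 0)"
    by (auto simp: tx_coeff_def tx_of_fps_def)
  ultimately show ?thesis
    by (auto simp: V_coeff_def tx_plus_def tx_coeff_def)
qed

lemma tx_coeff_del_hat_1: "tx_coeff (del_hat p \<gamma> (tx_monom 0 0)) = y_series W_coeff"
proof (intro ext)
  fix i k
  have "tx_coeff (W2 p \<gamma> \<otimes>\<^sub>t\<^sub>x tx_monom 0 0) i k = y_series W_coeff i k"
    unfolding tx_coeff_W2_times[OF tx_supported_monom[of 0 0, simplified]] y_series_def W_coeff_def
    by (auto simp: tx_coeff_def tx_monom_def intro!: sum.cong sum.neutral)
  then show "tx_coeff (del_hat p \<gamma> (tx_monom 0 0)) i k = y_series W_coeff i k"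
    by (simp add: del_hat_def tx_plus_def t_dt_def tx_coeff_def tx_monom_def)
qed

text \<open>The first summand is t d/dt of \<gamma> y. The truncated index \<open>k - 1\<close> is
  harmless at \<open>k = 0\<close> because \<open>W_coeff 0 = 0\<close>.\<close>

lemma tx_coeff_del_hat_gamma:
  "tx_coeff (del_hat p \<gamma> (gamma_t_over_x \<gamma>)) =
     y_series (\<lambda>k. (if k = 1 then \<gamma> else 0) + \<gamma> * W_coeff (k - 1))"
proof (intro ext)
  fix i k
  have "(if p ^ j \<le> k then tx_coeff (gamma_t_over_x \<gamma>) i (k - p ^ j) else 0)
      = (if i = 0 then \<gamma> * (if k - 1 = p ^ j then 1 else 0) else 0)" for j
  proof -
    define q where "q = p ^ j"
    have "q \<ge> 1" by (simp add: q_def Suc_leI)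
    then have "q \<le> k \<and> k - q = 1 \<and> int i - int (k - q) = - 1 \<longleftrightarrow> i = 0 \<and> k - 1 = q"
      by auto
    then show ?thesis
      unfolding q_def[symmetric] by (auto simp: tx_coeff_def gamma_t_over_x_def tx_scale_def tx_monom_def)
  qed
  then have "tx_coeff (W2 p \<gamma> \<otimes>\<^sub>t\<^sub>x gamma_t_over_x \<gamma>) i k =
      (\<Sum>j\<le>k. w_coef j * (if i = 0 then \<gamma> * (if k - 1 = p ^ j then 1 else 0) else 0))"
    unfolding tx_coeff_W2_times[OF tx_supported_gamma] by simp
  also have "\<dots> = (\<Sum>j\<le>k - 1. w_coef j * (if i = 0 then \<gamma> * (if k - 1 = p ^ j then 1 else 0) else 0))"
  proof (rule sum.mono_neutral_right)
    show "\<forall>j\<in>{..k} - {..k - 1}. w_coef j * (if i = 0 then \<gamma> * (if k - 1 = p ^ j then 1 else 0) else 0) = 0"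
    proof
      fix j assume "j \<in> {..k} - {..k - 1}"
      then have "k - 1 \<noteq> p ^ j" using less_power_p[of j] by auto
      then show "w_coef j * (if i = 0 then \<gamma> * (if k - 1 = p ^ j then 1 else 0) else 0) = 0" by simp
    qed
  qed auto
  also have "\<dots> = (if i = 0 then \<gamma> * W_coeff (k - 1) else 0)"
    by (auto simp: W_coeff_def sum_distrib_left mult_ac)
  finally show "tx_coeff (del_hat p \<gamma> (gamma_t_over_x \<gamma>)) i k =
      y_series (\<lambda>k. (if k = 1 then \<gamma> else 0) + \<gamma> * W_coeff (k - 1)) i k"
    by (auto simp: del_hat_def tx_plus_def t_dt_def tx_coeff_def gamma_t_over_x_def tx_scale_def tx_monom_def y_series_def)
qed

lemma cong_mod_D_hat_coeff:
  assumes "cong_mod_D_hat p ordp \<gamma> b' b F (tx_of_fps h0 \<oplus>\<^sub>t\<^sub>x tx_of_fps h1 \<otimes>\<^sub>t\<^sub>x gamma_t_over_x \<gamma>)"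
  obtains x \<rho> where "in_K \<rho> x"
    "\<And>i k. tx_coeff F i k = V_coeff (fps_nth h0) (\<lambda>n. \<gamma> * fps_nth h1 n) i k
       + (of_int (int i - int k) * x i k + W1_mult x i k)"
proof -
  obtain \<xi> \<rho> where \<xi>: "\<xi> \<in> K_space_rho ordp \<gamma> b' b \<rho>"
      and F: "F = (tx_of_fps h0 \<oplus>\<^sub>t\<^sub>x tx_of_fps h1 \<otimes>\<^sub>t\<^sub>x gamma_t_over_x \<gamma>) \<oplus>\<^sub>t\<^sub>x D_hat p \<gamma> \<xi>"
    using assms unfolding cong_mod_D_hat_def K_space_def by blast
  have "tx_coeff (A \<oplus>\<^sub>t\<^sub>x B) i k = tx_coeff A i k + tx_coeff B i k" for A B :: "'a txseries" and i k
    by (simp add: tx_coeff_def tx_plus_def)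
  then have "tx_coeff F i k = V_coeff (fps_nth h0) (\<lambda>n. \<gamma> * fps_nth h1 n) i k
       + (of_int (int i - int k) * tx_coeff \<xi> i k + W1_mult (tx_coeff \<xi>) i k)" for i k
    unfolding F using tx_coeff_V tx_coeff_D_hat[OF K_space_rho_supported[OF \<xi>]] by metis
  then show thesis using that K_space_rho_in_K[OF \<xi>] by blast
qed

lemma vge_gamma_cancel: "vge (\<gamma> * x) (r + 1 / (real p - 1)) \<Longrightarrow> vge x r"
  by (cases "x = 0") (auto simp: vge_iff val_mult)

text \<open>Both rows come from \<open>reduction_estimate\<close>, with \<sigma> = -\<epsilon> for
  the first and \<sigma> = -2\<epsilon> for the second. For the diagonal entries, parity removes the
  coefficients of \<open>W2\<close> from the main term.\<close>

lemma H_hat_estimates: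
  assumes "is_H_hat p ordp \<gamma> b' b H"
  shows "vge (fps_nth (H 0 0) n) (2 * b' * real n)"
    and "vge (fps_nth (H 0 1) n) (2 * b' * real n)"
    and "fps_nth (H 0 1) 0 \<noteq> 0" and "val (fps_nth (H 0 1) 0) = 0"
    and "vge (fps_nth (H 1 0) n) (2 * b' * real n - 2 * \<epsilon>)"
    and "fps_nth (H 1 0) 0 = 0"
    and "vge (fps_nth (H 1 1) n) (2 * b' * real n)"
proof -
  have W: "vge (W_coeff k) (b * real k + - \<epsilon>)" for k
  proof (cases "k = 0")
    case False
    then show ?thesis using w_coef_weight[of "real k"] by (intro vge_mono[OF vge_W_coeff]) simp
  qed simp
  obtain x \<rho> where x: "in_K \<rho> x"
    "\<And>i k. y_series W_coeff i k = V_coeff (fps_nth (H 0 0)) (\<lambda>n. \<gamma> * fps_nth (H 0 1) n) i k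
       + (of_int (int i - int k) * x i k + W1_mult x i k)"
    using assms cong_mod_D_hat_coeff unfolding is_H_hat_def tx_coeff_del_hat_1[symmetric] by metis
  note est = reduction_estimate[OF x(2) W x(1)]
  show "vge (fps_nth (H 0 0) n) (2 * b' * real n)" using est(1)[of n] by simp
  have H01: "vge (\<gamma> * fps_nth (H 0 1) n - W_coeff (Suc (2 * n))) (2 * b' * real n + b)" for n
    using est(2)[of n] by simp
  show "vge (fps_nth (H 0 1) n) (2 * b' * real n)"
  proof (rule vge_gamma_cancel)
    have "vge (\<gamma> * fps_nth (H 0 1) n - W_coeff (Suc (2 * n))) (2 * b' * real n + 1 / (real p - 1))"
      using b_gt by (intro vge_mono[OF H01]) simp
    moreover have "vge (W_coeff (Suc (2 * n))) (2 * b' * real n + 1 / (real p - 1))"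
    proof (rule vge_mono[OF vge_W_coeff])
      have "b' * (2 * real n) \<le> real p / (real p - 1) * (2 * real n)"
        using b'_le b_le by (intro mult_right_mono) auto
      moreover have "real p / (real p - 1) * real (Suc (2 * n)) - 1
          = real p / (real p - 1) * (2 * real n) + (real p / (real p - 1) - 1)"
        by (simp add: distrib_left)
      ultimately show "2 * b' * real n + 1 / (real p - 1) \<le> real p / (real p - 1) * real (Suc (2 * n)) - 1"
        using b_hat by (simp add: mult_ac)
    qed
    ultimately show "vge (\<gamma> * fps_nth (H 0 1) n) (2 * b' * real n + 1 / (real p - 1))"
      using vge_add by fastforce
  qed
  \<comment> \<open>\<open>b\<close> exceeds the valuation of \<gamma>, so
    \<open>\<gamma> * fps_nth (H 0 1) 0\<close> has the valuation of \<gamma> and the other factor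
    is a unit.\<close>
  have "vge (\<gamma> * fps_nth (H 0 1) 0 - \<gamma>) b" using H01[of 0] by simp
  from val_add_eq[OF gamma_nz this] b_gt
  have "\<gamma> * fps_nth (H 0 1) 0 \<noteq> 0" "val (\<gamma> * fps_nth (H 0 1) 0) = val \<gamma>" by simp_all
  then show "fps_nth (H 0 1) 0 \<noteq> 0" "val (fps_nth (H 0 1) 0) = 0" by (auto simp: val_mult)
  define c where "c k = (if k = 1 then \<gamma> else 0) + \<gamma> * W_coeff (k - 1)" for k
  have c: "vge (c k) (b * real k + - (2 * \<epsilon>))" for k
    unfolding c_def
  proof (rule vge_add)
    show "vge (if k = 1 then \<gamma> else 0) (b * real k + - (2 * \<epsilon>))"
      using eps_pos by (simp add: vge_iff eps_def)
    show "vge (\<gamma> * W_coeff (k - 1)) (b * real k + - (2 * \<epsilon>))"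
    proof (cases "k = 0")
      case False
      have "vge \<gamma> (b - \<epsilon>)" by (simp add: vge_iff eps_def)
      from vge_mult_le[OF this W] show ?thesis using False by (simp add: of_nat_diff algebra_simps)
    qed simp
  qed
  obtain x \<rho> where x: "in_K \<rho> x"
    "\<And>i k. y_series c i k = V_coeff (fps_nth (H 1 0)) (\<lambda>n. \<gamma> * fps_nth (H 1 1) n) i k
       + (of_int (int i - int k) * x i k + W1_mult x i k)"
    using assms cong_mod_D_hat_coeff
    unfolding is_H_hat_def c_def tx_coeff_del_hat_gamma[symmetric] by metis
  note est = reduction_estimate[OF x(2) c x(1)]
  show "fps_nth (H 1 0) 0 = 0" using est(3) by (simp add: c_def)
  have "vge (fps_nth (H 1 0) n - c (2 * n)) (2 * b' * real n - 2 * \<epsilon>)"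
    using eps_pos by (intro vge_mono[OF est(1)]) simp
  moreover have "vge (c (2 * n)) (2 * b' * real n - 2 * \<epsilon>)"
    using b'_le by (intro vge_mono[OF c]) (simp add: mult_right_mono)
  ultimately show "vge (fps_nth (H 1 0) n) (2 * b' * real n - 2 * \<epsilon>)"
    using vge_add by fastforce
  show "vge (fps_nth (H 1 1) n) (2 * b' * real n)"
  proof (rule vge_gamma_cancel)
    have "vge (\<gamma> * fps_nth (H 1 1) n - c (Suc (2 * n))) (2 * b' * real n + 1 / (real p - 1))"
      using est(2)[of n] by (simp add: eps_def algebra_simps)
    \<comment> \<open>As \<open>W_coeff (2 * n) = 0\<close>, this coefficient is \<gamma> for
      \<open>n = 0\<close> and 0 otherwise.\<close>
    moreover have "vge (c (Suc (2 * n))) (2 * b' * real n + 1 / (real p - 1))"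
      by (auto simp: c_def vge_iff)
    ultimately show "vge (\<gamma> * fps_nth (H 1 1) n) (2 * b' * real n + 1 / (real p - 1))"
      using vge_add by fastforce
  qed
qed

end

section \<open>The operator on symmetric powers\<close>

lemma S_series_add: "S_series \<kappa> A + S_series \<kappa> B = S_series \<kappa> (\<lambda>n m. A n m + B n m)"
  by (simp add: S_series_def fps_eq_iff algebra_simps)

lemma S_series_scale: "fps_const (fps_const c) * S_series \<kappa> A = S_series \<kappa> (\<lambda>n m. c * A n m)"
  by (simp add: S_series_def fps_eq_iff algebra_simps)

lemma fps_nth_w_div: "fps_nth (w_div \<kappa> m') m = (if m = m' then fps_const (falling \<kappa> m') else 0)"
  by (simp add: w_div_def fps_X_power_nth)

context splitting_root
begin

text \<open>Each \<open>a m\<close> is expressed by its successor, so there is no initial value. The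
  recursion is unrolled indefinitely; the products of the \<open>l m\<close> are integral and the
  growth of \<open>c\<close> gives convergence.\<close>

lemma backward_recursion_solvable:
  assumes "\<epsilon> > 0"
    and l: "\<And>m. l m \<in> Omega0 ordp \<gamma>" "\<And>m. vge (l m) 0"
    and c: "\<And>m. c m \<in> Omega0 ordp \<gamma>" "\<And>m. vge (c m) (s + \<epsilon> * real m)"
  shows "\<exists>a. \<forall>m. a m \<in> Omega0 ordp \<gamma> \<and> vge (a m) (s + \<epsilon> * real m) \<and> a m = c m + l m * a (Suc m)"
proof -
  define T where "T m k = (\<Prod>i<k. l (m + i)) * c (m + k)" for m k
  define P where "P m K = (\<Sum>k<K. T m k)" for m K
  have prod: "vge (\<Prod>i<k. l (m + i)) 0" for m k
    by (induction k) (auto intro: vge_mult_le[OF _ l(2)])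
  have T: "vge (T m k) (s + \<epsilon> * real (m + k))" for m k
    unfolding T_def using vge_mult[OF prod[of m k] c(2)[of "m + k"]] by simp
  have P: "vge (P m K) (s + \<epsilon> * real m)" for m K
    unfolding P_def
    by (intro vge_sum vge_mono[OF T]) (use assms(1) in auto)
  have "P m K \<in> Omega0 ordp \<gamma>" for m K
    unfolding P_def T_def by (intro Omega0_sum Omega0_mult Omega0_prod l c)
  moreover have "\<exists>N. \<forall>i\<ge>N. \<forall>j\<ge>N. vge (P m i - P m j) M" for m M
  proof -
    obtain N where "(M - s) / \<epsilon> < real N" using reals_Archimedean2 by blast
    then have N: "M \<le> s + \<epsilon> * real N" using assms(1) by (simp add: field_simps)
    have *: "vge (P m N - P m i) M" if "i \<ge> N" for i
    proof -
      have "P m i = P m N + (\<Sum>k\<in>{N..<i}. T m k)"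
        unfolding P_def using that by (metis atLeast0LessThan sum.atLeastLessThan_concat zero_le)
      moreover have "vge (\<Sum>k\<in>{N..<i}. T m k) M"
      proof (intro vge_sum vge_mono[OF T])
        fix k assume "k \<in> {N..<i}"
        then have "\<epsilon> * real N \<le> \<epsilon> * real (m + k)" using assms(1) by (intro mult_left_mono) auto
        then show "M \<le> s + \<epsilon> * real (m + k)" using N by simp
      qed
      ultimately show ?thesis by simp
    qed
    have "vge (P m i - P m j) M" if "i \<ge> N" "j \<ge> N" for i j
      using vge_diff[OF *[OF that(2)] *[OF that(1)]] by simp
    then show ?thesis by blast
  qed
  ultimately have "\<exists>x\<in>Omega0 ordp \<gamma>. \<forall>M. \<exists>N. \<forall>n\<ge>N. vge (x - P m n) M" for m
    by (rule Omega0_Cauchy_convergent)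
  then obtain x where x: "\<And>m. x m \<in> Omega0 ordp \<gamma>" "\<And>m M. \<exists>N. \<forall>n\<ge>N. vge (x m - P m n) M"
    by metis
  have "vge (x m) (s + \<epsilon> * real m)" for m
  proof -
    obtain n where "vge (x m - P m n) (s + \<epsilon> * real m)" using x(2) by blast
    from vge_add[OF this P[of m n]] show ?thesis by simp
  qed
  moreover have "x m = c m + l m * x (Suc m)" for m
  proof (rule vge_uniq_limit[of _ "\<lambda>n. P m (Suc n)"])
    fix M
    show "\<exists>N. \<forall>n\<ge>N. vge (x m - P m (Suc n)) M" using x(2)[of m M] by (meson le_Suc_eq le_SucI)
    \<comment> \<open>Splitting off the first term of \<open>P m (Suc n)\<close> and passing to the
      limit yields the recursion for \<open>x\<close>.\<close>
    have rec: "P m (Suc n) = c m + l m * P (Suc m) n" for n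
      unfolding P_def T_def sum.lessThan_Suc_shift prod.lessThan_Suc_shift
      by (simp add: sum_distrib_left mult.assoc)
    obtain N where N: "\<forall>n\<ge>N. vge (x (Suc m) - P (Suc m) n) M" using x(2) by blast
    have "vge (c m + l m * x (Suc m) - P m (Suc n)) M" if "n \<ge> N" for n
    proof -
      have "vge (l m * (x (Suc m) - P (Suc m) n)) M"
        using N that by (intro vge_mult_le[OF l(2)]) auto
      then show ?thesis by (simp add: rec algebra_simps)
    qed
    then show "\<exists>N. \<forall>n\<ge>N. vge (c m + l m * x (Suc m) - P m (Suc n)) M" by blast
  qed
  ultimately show ?thesis using x(1) by blast
qed

end

locale symmetric_power_setting = kloosterman_setting p ordp \<gamma> b b' \<epsilon>
  for p and ordp :: "'a::{alg_closed_field, field_char_0} \<Rightarrow> ereal" and \<gamma> b b' \<epsilon> +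
  fixes \<kappa> :: 'a and H :: "nat \<Rightarrow> nat \<Rightarrow> 'a fps"
  assumes H_hat: "is_H_hat p ordp \<gamma> b' b H"
    and kappa_Zp: "\<kappa> \<in> Zp ordp" and kappa_not_Nats: "\<kappa> \<notin> \<nat>"
begin

section \<open>The operator in coefficients with respect to w^(m)\<close>

lemma kappa_Omega0: "\<kappa> \<in> Omega0 ordp \<gamma>"
  using kappa_Zp Qp_subset_Omega0 by (auto simp: Zp_def)

lemma vge_kappa: "vge \<kappa> 0"
  using kappa_Zp by (simp add: Zp_def vge_def zero_ereal_def)

lemma falling_nz [simp]: "falling \<kappa> m \<noteq> 0"
  using kappa_not_Nats unfolding falling_def by (auto simp: Nats_def)

lemma H_Omega0:
  assumes "i \<in> {0, 1}" "j \<in> {0, 1}"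
  shows "fps_nth (H i j) n \<in> Omega0 ordp \<gamma>"
  using H_hat assms unfolding is_H_hat_def L_space_def L_space_rho_def by fastforce

lemma w_coeff_S_series: "w_coeff \<kappa> (S_series \<kappa> A) m = Abs_fps (\<lambda>n. A n m)"
  by (simp add: w_coeff_def S_series_def fps_eq_iff)

text \<open>No \<open>falling \<kappa> m\<close> vanishes, so every coefficient can be divided by
  it.\<close>

lemma S_series_exists: "\<exists>A. F = S_series \<kappa> A"
  by (rule exI[of _ "\<lambda>n m. fps_nth (w_coeff \<kappa> F m) n"])
    (simp add: w_coeff_def S_series_def fps_eq_iff)

lemma S_series_eq_iff: "S_series \<kappa> A = S_series \<kappa> B \<longleftrightarrow> A = B"
  by (auto simp: S_series_def fps_eq_iff fun_eq_iff)

lemma S_series_0: "S_series \<kappa> (\<lambda>n m. 0) = 0"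
  by (simp add: S_series_def fps_eq_iff)

lemma S_series_const_iff: "(\<exists>G. S_series \<kappa> A = fps_const G) \<longleftrightarrow> (\<forall>n m. A n (Suc m) = 0)"
proof
  assume "\<exists>G. S_series \<kappa> A = fps_const G"
  then obtain G where G: "S_series \<kappa> A = fps_const G" by blast
  show "\<forall>n m. A n (Suc m) = 0"
  proof (intro allI)
    fix n m
    have "fps_nth (fps_nth (S_series \<kappa> A) (Suc m)) n = 0" by (simp add: G)
    then show "A n (Suc m) = 0" by (simp add: S_series_def)
  qed
next
  assume A: "\<forall>n m. A n (Suc m) = 0"
  have "fps_nth (S_series \<kappa> A) m = fps_nth (fps_const (fps_nth (S_series \<kappa> A) 0)) m" for m
    using A by (cases m) (auto simp: S_series_def fps_eq_iff)
  then show "\<exists>G. S_series \<kappa> A = fps_const G" by (metis fps_ext)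
qed

text \<open>The part of the coefficient of w^(m) in the image that comes from the coefficient of t^j
  in \<open>H\<close>. The last term is the image of w^(m+1), so the factor m(\<kappa> - m + 1)
  appears with \<open>m + 1\<close> in place of \<open>m\<close>.\<close>

definition L_op :: "nat \<Rightarrow> (nat \<Rightarrow> 'a) \<Rightarrow> nat \<Rightarrow> 'a" where
  "L_op j g m = ((\<kappa> - of_nat m) * fps_nth (H 0 0) j + of_nat m * fps_nth (H 1 1) j) * g m
     + (case m of 0 \<Rightarrow> 0 | Suc m' \<Rightarrow> fps_nth (H 0 1) j * g m')
     + of_nat (Suc m) * (\<kappa> - of_nat m) * fps_nth (H 1 0) j * g (Suc m)"

definition del_op :: "(nat \<Rightarrow> nat \<Rightarrow> 'a) \<Rightarrow> nat \<Rightarrow> nat \<Rightarrow> 'a" where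
  "del_op A n m = of_nat n * A n m + (\<Sum>j\<le>n. L_op j (A (n - j)) m)"

lemma fps_nth_L_kappa_S_series:
  "fps_nth (L_kappa \<kappa> H (S_series \<kappa> A)) m =
    ((fps_const (\<kappa> - of_nat m) * H 0 0 + of_nat m * H 1 1) * Abs_fps (\<lambda>n. A n m)
     + (case m of 0 \<Rightarrow> 0 | Suc m' \<Rightarrow> H 0 1 * Abs_fps (\<lambda>n. A n m'))
     + fps_const (of_nat (Suc m) * (\<kappa> - of_nat m)) * H 1 0 * Abs_fps (\<lambda>n. A n (Suc m)))
    * fps_const (falling \<kappa> m)"
proof -
  define a where "a m = Abs_fps (\<lambda>n. A n m)" for m
  \<comment> \<open>Only w^(m), w^(m-1) and w^(m+1) have images that involve the power
    \<open>m\<close> of w; they contribute \<open>T1\<close>, \<open>T2\<close> and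
    \<open>T3\<close>.\<close>
  define T1 where "T1 = a m * (fps_const (\<kappa> - of_nat m) * H 0 0 + of_nat m * H 1 1) * fps_const (falling \<kappa> m)"
  define T2 where "T2 m' = a m' * H 0 1 * fps_const (falling \<kappa> m)" for m'
  define T3 where "T3 = a (Suc m) * (fps_const (of_nat (Suc m) * (\<kappa> - of_nat m)) * H 1 0) * fps_const (falling \<kappa> m)"
  have "a m' * fps_nth (L_kappa_basis \<kappa> H m') m =
      (if m' = m then T1 else 0) + (if Suc m' = m then T2 m' else 0) + (if m' = Suc m then T3 else 0)" for m'
  proof -
    consider "m' = m" | "m = Suc m'" | "m' = Suc m" | "m \<noteq> m'" "m \<noteq> Suc m'" "m' \<noteq> Suc m" by blast
    then show ?thesis
    proof cases
      case 1
      then show ?thesis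
        by (cases m) (simp_all add: L_kappa_basis_def fps_nth_w_div T1_def algebra_simps)
    next
      case 2
      then show ?thesis
        by (cases m') (simp_all add: L_kappa_basis_def fps_nth_w_div T2_def algebra_simps)
    next
      case 3
      then show ?thesis
        by (simp add: L_kappa_basis_def fps_nth_w_div T3_def algebra_simps)
    next
      case 4
      then show ?thesis
        by (cases m') (auto simp: L_kappa_basis_def fps_nth_w_div)
    qed
  qed
  then have "fps_nth (L_kappa \<kappa> H (S_series \<kappa> A)) m =
      (\<Sum>m'\<le>Suc m. if m' = m then T1 else 0) + (\<Sum>m'\<le>Suc m. if Suc m' = m then T2 m' else 0)
      + (\<Sum>m'\<le>Suc m. if m' = Suc m then T3 else 0)"
    by (simp add: L_kappa_def w_coeff_S_series a_def[symmetric] sum.distrib del: sum.atMost_Suc)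
  also have "(\<Sum>m'\<le>Suc m. if Suc m' = m then T2 m' else 0) = (case m of 0 \<Rightarrow> 0 | Suc m' \<Rightarrow> T2 m')"
    by (cases m) (simp_all add: sum.delta del: sum.atMost_Suc)
  also have "(\<Sum>m'\<le>Suc m. if m' = m then T1 else 0) = T1"
    by (simp add: sum.delta del: sum.atMost_Suc)
  also have "(\<Sum>m'\<le>Suc m. if m' = Suc m then T3 else 0) = T3"
    by (simp add: sum.delta del: sum.atMost_Suc)
  finally show ?thesis
    by (cases m) (simp_all add: T1_def T2_def T3_def a_def algebra_simps)
qed

lemma del_kappa_S_series: "del_kappa \<kappa> H (S_series \<kappa> A) = S_series \<kappa> (del_op A)"
proof (intro fps_ext)
  fix m n
  have mult: "fps_nth (G * Abs_fps f) n = (\<Sum>j\<le>n. fps_nth G j * f (n - j))" for G :: "'a fps" and f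
    by (simp add: fps_mult_nth atMost_atLeast0)
  have "fps_nth ((fps_const (\<kappa> - of_nat m) * H 0 0 + of_nat m * H 1 1) * Abs_fps (\<lambda>n. A n m)
     + (case m of 0 \<Rightarrow> 0 | Suc m' \<Rightarrow> H 0 1 * Abs_fps (\<lambda>n. A n m'))
     + fps_const (of_nat (Suc m) * (\<kappa> - of_nat m)) * H 1 0 * Abs_fps (\<lambda>n. A n (Suc m))) n
     = (\<Sum>j\<le>n. L_op j (A (n - j)) m)"
    by (cases m) (simp_all add: L_op_def mult sum.distrib fps_mult_of_nat_nth del: of_nat_Suc)
  then show "fps_nth (fps_nth (del_kappa \<kappa> H (S_series \<kappa> A)) m) n
      = fps_nth (fps_nth (S_series \<kappa> (del_op A)) m) n"
    by (cases n) (simp_all add: del_kappa_def fps_nth_L_kappa_S_series t_ddt_def, simp_all add: S_series_def del_op_def algebra_simps)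
qed

lemma L_op_add: "L_op j (\<lambda>m. f m + g m) m = L_op j f m + L_op j g m"
  by (simp add: L_op_def algebra_simps split: nat.split)

lemma L_op_scale: "L_op j (\<lambda>m. c * g m) m = c * L_op j g m"
  by (simp add: L_op_def algebra_simps split: nat.split)

lemma del_op_add: "del_op (\<lambda>n m. A n m + B n m) = (\<lambda>n m. del_op A n m + del_op B n m)"
  by (simp add: fun_eq_iff del_op_def L_op_add sum.distrib algebra_simps)

lemma del_op_scale: "del_op (\<lambda>n m. c * A n m) = (\<lambda>n m. c * del_op A n m)"
  by (simp add: fun_eq_iff del_op_def L_op_scale sum_distrib_left algebra_simps)

lemma del_kappa_add: "del_kappa \<kappa> H (F + G) = del_kappa \<kappa> H F + del_kappa \<kappa> H G"
proof -
  obtain A B where "F = S_series \<kappa> A" "G = S_series \<kappa> B" using S_series_exists by meson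
  then show ?thesis by (simp add: S_series_add del_kappa_S_series del_op_add)
qed

lemma del_kappa_scale: "del_kappa \<kappa> H (fps_const (fps_const c) * F) = fps_const (fps_const c) * del_kappa \<kappa> H F"
proof -
  obtain A where "F = S_series \<kappa> A" using S_series_exists by meson
  then show ?thesis by (simp add: S_series_scale del_kappa_S_series del_op_scale)
qed

text \<open>No term loses more than \<epsilon>: \<open>H 0 1\<close> meets \<open>g\<close> at
  \<open>m - 1\<close>, which costs \<epsilon>, and \<open>H 1 0\<close> costs
  \<open>2 * \<epsilon>\<close> but meets \<open>g\<close> at \<open>m + 1\<close>, which regains
  \<epsilon>.\<close>

lemma L_op_bound:
  assumes "j \<le> n" and g: "\<And>m. g m \<in> Omega0 ordp \<gamma>" "\<And>m. vge (g m) (2 * b' * real (n - j) + \<epsilon> * real m + (\<rho> + \<epsilon>))"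
  shows "L_op j g m \<in> Omega0 ordp \<gamma>" "vge (L_op j g m) (2 * b' * real n + \<epsilon> * real m + \<rho>)"
proof -
  show "L_op j g m \<in> Omega0 ordp \<gamma>"
    unfolding L_op_def
    by (intro Omega0_add Omega0_mult Omega0_diff kappa_Omega0 Omega0_of_nat H_Omega0 g)
      (auto split: nat.split intro!: Omega0_mult H_Omega0 g)
  have n: "2 * b' * real n = 2 * b' * real j + 2 * b' * real (n - j)"
    using assms(1) by (simp add: of_nat_diff algebra_simps)
  note est = H_hat_estimates[OF H_hat]
  have km: "vge (\<kappa> - of_nat m) 0" by (intro vge_diff vge_kappa) simp
  have "vge ((\<kappa> - of_nat m) * fps_nth (H 0 0) j + of_nat m * fps_nth (H 1 1) j) (2 * b' * real j)"
    using vge_mult[OF km est(1)] by (intro vge_add vge_of_nat_mult est) simp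
  then have 1: "vge (((\<kappa> - of_nat m) * fps_nth (H 0 0) j + of_nat m * fps_nth (H 1 1) j) * g m) (2 * b' * real n + \<epsilon> * real m + \<rho>)"
    by (rule vge_mult_le[OF _ g(2)]) (use n eps_pos in simp)
  have 2: "vge (case m of 0 \<Rightarrow> 0 | Suc m' \<Rightarrow> fps_nth (H 0 1) j * g m') (2 * b' * real n + \<epsilon> * real m + \<rho>)"
  proof (cases m)
    case (Suc m')
    have "vge (fps_nth (H 0 1) j * g m') (2 * b' * real n + \<epsilon> * real m + \<rho>)"
      by (rule vge_mult_le[OF est(2) g(2)]) (use n Suc in \<open>simp add: algebra_simps\<close>)
    then show ?thesis using Suc by simp
  qed simp
  have "vge (of_nat (Suc m) * (\<kappa> - of_nat m) * fps_nth (H 1 0) j) (2 * b' * real j - 2 * \<epsilon>)"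
    using vge_mult[OF vge_of_nat_mult[OF km, of "Suc m"] est(5)[of j]] by simp
  then have 3: "vge (of_nat (Suc m) * (\<kappa> - of_nat m) * fps_nth (H 1 0) j * g (Suc m)) (2 * b' * real n + \<epsilon> * real m + \<rho>)"
    by (rule vge_mult_le[OF _ g(2)]) (use n in \<open>simp add: algebra_simps\<close>)
  show "vge (L_op j g m) (2 * b' * real n + \<epsilon> * real m + \<rho>)"
    unfolding L_op_def by (rule vge_add[OF vge_add[OF 1 2] 3])
qed

definition in_S :: "real \<Rightarrow> (nat \<Rightarrow> nat \<Rightarrow> 'a) \<Rightarrow> bool" where
  "in_S \<rho> A \<longleftrightarrow> (\<forall>n m. A n m \<in> Omega0 ordp \<gamma> \<and> vge (A n m) (2 * b' * real n + \<epsilon> * real m + \<rho>))"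

lemma S_space_rho_eq: "S_space_rho ordp \<gamma> \<kappa> b' \<epsilon> \<rho> = {S_series \<kappa> A |A. in_S \<rho> A}"
  by (simp add: S_space_rho_def in_S_def vge_def)

lemma S_series_in_S_space_rho_iff: "S_series \<kappa> A \<in> S_space_rho ordp \<gamma> \<kappa> b' \<epsilon> \<rho> \<longleftrightarrow> in_S \<rho> A"
  by (auto simp: S_space_rho_eq S_series_eq_iff)

lemma in_S_del_op: assumes "in_S (\<rho> + \<epsilon>) A" shows "in_S \<rho> (del_op A)"
  unfolding in_S_def
proof (intro allI conjI)
  fix n m
  have A: "\<And>m. A n m \<in> Omega0 ordp \<gamma>" "\<And>m. vge (A n m) (2 * b' * real n + \<epsilon> * real m + (\<rho> + \<epsilon>))" for n
    using assms by (auto simp: in_S_def)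
  show "del_op A n m \<in> Omega0 ordp \<gamma>"
    unfolding del_op_def by (intro Omega0_add Omega0_sum Omega0_mult Omega0_of_nat A L_op_bound(1)[OF _ A]) auto
  show "vge (del_op A n m) (2 * b' * real n + \<epsilon> * real m + \<rho>)"
    unfolding del_op_def
  proof (intro vge_add vge_sum vge_of_nat_mult)
    show "vge (A n m) (2 * b' * real n + \<epsilon> * real m + \<rho>)"
      by (rule vge_mono[OF A(2)]) (use eps_pos in simp)
  qed (auto intro: L_op_bound(2)[OF _ A])
qed

section \<open>The equations in positive w-degree\<close>

definition del_diag :: "nat \<Rightarrow> nat \<Rightarrow> 'a" where
  "del_diag n m = of_nat n + ((\<kappa> - of_nat m) * fps_nth (H 0 0) 0 + of_nat m * fps_nth (H 1 1) 0)"

text \<open>The constant term of \<open>H 1 0\<close> vanishes, so at level \<open>n\<close> only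
  \<open>A n m\<close> and \<open>A n (Suc m)\<close> occur; all other entries belong to smaller
  powers of t.\<close>

lemma del_op_Suc:
  "del_op A n (Suc m) = fps_nth (H 0 1) 0 * A n m + del_diag n (Suc m) * A n (Suc m)
     + (\<Sum>j\<in>{1..n}. L_op j (A (n - j)) (Suc m))"
proof -
  have "(\<Sum>j\<le>n. L_op j (A (n - j)) (Suc m)) = L_op 0 (A n) (Suc m) + (\<Sum>j\<in>{1..n}. L_op j (A (n - j)) (Suc m))"
    by (simp add: atMost_atLeast0 sum.atLeast_Suc_atMost)
  moreover have "L_op 0 (A n) (Suc m) = ((\<kappa> - of_nat (Suc m)) * fps_nth (H 0 0) 0 + of_nat (Suc m) * fps_nth (H 1 1) 0) * A n (Suc m)
      + fps_nth (H 0 1) 0 * A n m"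
    using H_hat_estimates(6)[OF H_hat] by (simp add: L_op_def)
  ultimately show ?thesis by (simp add: del_op_def del_diag_def algebra_simps)
qed

lemma del_diag_bound: "del_diag n m \<in> Omega0 ordp \<gamma>" "vge (del_diag n m) 0"
proof -
  show "del_diag n m \<in> Omega0 ordp \<gamma>"
    unfolding del_diag_def
    by (intro Omega0_add Omega0_mult Omega0_diff kappa_Omega0 Omega0_of_nat H_Omega0) auto
  note est = H_hat_estimates(1,7)[OF H_hat, of 0]
  have "vge (\<kappa> - of_nat m) 0" by (intro vge_diff vge_kappa) simp
  from vge_mult[OF this est(1)] show "vge (del_diag n m) 0"
    unfolding del_diag_def using est(2) by (intro vge_add vge_of_nat_mult) simp_all
qed

lemma H01_inverse: "vge (inverse (fps_nth (H 0 1) 0)) 0"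
  using H_hat_estimates(3,4)[OF H_hat] by (simp add: vge_iff val_inverse)

text \<open>By induction on \<open>n\<close> the lower levels vanish. Then \<open>A n m\<close> is
  an integral multiple of every \<open>A n (m + k)\<close>, whose valuation grows without bound.
  Leaving \<open>del_op A n 0\<close> free makes this cover both the kernel and the intersection
  with series constant in w.\<close>

lemma del_op_injective:
  assumes A: "in_S \<rho> A" and del: "\<And>n m. del_op A n (Suc m) = 0"
  shows "A = (\<lambda>n m. 0)"
proof -
  have "\<forall>m. A n m = 0" for n
  proof (induction n rule: less_induct)
    case (less n)
    have "(\<Sum>j\<in>{1..n}. L_op j (A (n - j)) (Suc m)) = 0" for m
      using less by (intro sum.neutral ballI) (simp add: L_op_def)
    then have "fps_nth (H 0 1) 0 * A n m = - (del_diag n (Suc m) * A n (Suc m))" for m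
      using del[of n m] unfolding del_op_Suc by (simp add: add_eq_0_iff2)
    then have rec: "A n m = - inverse (fps_nth (H 0 1) 0) * del_diag n (Suc m) * A n (Suc m)" for m
      using H_hat_estimates(3)[OF H_hat] by (simp add: field_simps)
    have "vge (- inverse (fps_nth (H 0 1) 0)) 0" using H01_inverse by simp
    then have "vge (- inverse (fps_nth (H 0 1) 0) * del_diag n (Suc m)) 0" for m
      by (rule vge_mult_le[OF _ del_diag_bound(2)]) simp
    then have mono: "vge (A n m) r" if "vge (A n (Suc m)) r" for m r
      unfolding rec[of m] by (rule vge_mult_le[OF _ that]) simp
    have shift: "vge (A n m) r" if "vge (A n (m + k)) r" for m k r
      using that by (induction k) (auto intro: mono)
    have "A n m = 0" for m
    proof (rule vge_all_imp_0)
      fix r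
      obtain k where "(r - 2 * b' * real n - \<rho>) / \<epsilon> < real k" using reals_Archimedean2 by blast
      then have "r \<le> 2 * b' * real n + \<epsilon> * real k + \<rho>" using eps_pos by (simp add: field_simps)
      also have "\<dots> \<le> 2 * b' * real n + \<epsilon> * real (m + k) + \<rho>"
        using eps_pos by (simp add: algebra_simps)
      finally have "vge (A n (m + k)) r" using A vge_mono unfolding in_S_def by blast
      then show "vge (A n m) r" by (rule shift)
    qed
    then show ?case by blast
  qed
  then show ?thesis by (simp add: fun_eq_iff)
qed

text \<open>This produces the component in the image of \<open>del_kappa\<close>: all equations in
  positive w-degree are solved, and what remains in w-degree 0 is left to the complement.\<close>

lemma del_op_solvable:
  assumes B: "in_S \<rho> B"
  shows "\<exists>A. in_S (\<rho> + \<epsilon>) A \<and> (\<forall>n m. del_op A n (Suc m) = B n (Suc m))"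
proof -
  define h where "h = fps_nth (H 0 1) 0"
  have h: "h \<noteq> 0" "vge (inverse h) 0" "inverse h \<in> Omega0 ordp \<gamma>"
    using H_hat_estimates(3)[OF H_hat] H01_inverse by (simp_all add: h_def Omega0_inverse H_Omega0)
  define rest where "rest A n m = (\<Sum>j\<in>{1..n}. L_op j (A (n - j)) m)" for A n m
  define Q where "Q A n a \<longleftrightarrow> (\<forall>m. a m \<in> Omega0 ordp \<gamma> \<and> vge (a m) (2 * b' * real n + \<epsilon> * real m + (\<rho> + \<epsilon>)) \<and>
      h * a m + del_diag n (Suc m) * a (Suc m) + rest A n (Suc m) = B n (Suc m))" for A n a
  \<comment> \<open>\<open>rest A n\<close> only uses levels below \<open>n\<close>, so the levels
    of \<open>A\<close> can be chosen by well-founded recursion.\<close>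
  have "\<exists>A. \<forall>n. Q A n (A n)"
  proof (rule dependent_wellorder_choice)
    fix a A A' n assume "\<And>k::nat. k < n \<Longrightarrow> A k = (A' k :: nat \<Rightarrow> 'a)"
    then have "rest A n m = rest A' n m" for m unfolding rest_def by (intro sum.cong) auto
    then show "Q A n a = Q A' n a" by (simp add: Q_def)
  next
    fix n A assume "\<And>k. k < n \<Longrightarrow> Q A k (A k)"
    then have A: "\<And>m. A k m \<in> Omega0 ordp \<gamma>" "\<And>m. vge (A k m) (2 * b' * real k + \<epsilon> * real m + (\<rho> + \<epsilon>))"
      if "k < n" for k using that by (auto simp: Q_def)
    have rest: "rest A n m \<in> Omega0 ordp \<gamma>" "vge (rest A n m) (2 * b' * real n + \<epsilon> * real m + \<rho>)" for m
      unfolding rest_def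
      by (intro Omega0_sum L_op_bound(1)[OF _ A], auto)
        (intro vge_sum L_op_bound(2)[OF _ A], auto)
    \<comment> \<open>Division by the unit \<open>h\<close> gives the form required by
      \<open>backward_recursion_solvable\<close>; passing from index \<open>Suc m\<close> to
      \<open>m\<close> provides the additional \<epsilon>.\<close>
    define c where "c m = inverse h * (B n (Suc m) - rest A n (Suc m))" for m
    define l where "l m = - (inverse h * del_diag n (Suc m))" for m
    have "\<exists>a. \<forall>m. a m \<in> Omega0 ordp \<gamma> \<and> vge (a m) (2 * b' * real n + (\<rho> + \<epsilon>) + \<epsilon> * real m) \<and> a m = c m + l m * a (Suc m)"
    proof (rule backward_recursion_solvable)
      fix m
      show "l m \<in> Omega0 ordp \<gamma>" "c m \<in> Omega0 ordp \<gamma>" using B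
        unfolding l_def c_def in_S_def by (auto intro!: Omega0_minus Omega0_mult Omega0_diff h del_diag_bound rest)
      show "vge (l m) 0" using vge_mult[OF h(2) del_diag_bound(2)] by (simp add: l_def)
      have "vge (B n (Suc m) - rest A n (Suc m)) (2 * b' * real n + \<epsilon> * real (Suc m) + \<rho>)"
        by (rule vge_diff[OF _ rest(2)]) (use B in \<open>auto simp: in_S_def simp del: of_nat_Suc\<close>)
      from vge_mult[OF h(2) this] show "vge (c m) (2 * b' * real n + (\<rho> + \<epsilon>) + \<epsilon> * real m)"
        by (simp add: c_def algebra_simps)
    qed (rule eps_pos)
    then obtain a where a: "\<And>m. a m \<in> Omega0 ordp \<gamma>" "\<And>m. vge (a m) (2 * b' * real n + (\<rho> + \<epsilon>) + \<epsilon> * real m)"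
        "\<And>m. a m = c m + l m * a (Suc m)"
      by blast
    have "h * a m + del_diag n (Suc m) * a (Suc m) + rest A n (Suc m) = B n (Suc m)" for m
      using h(1) unfolding a(3)[of m] c_def l_def by (simp add: field_simps)
    then show "\<exists>a. Q A n a" using a(1,2) unfolding Q_def by (intro exI[of _ a]) (simp add: algebra_simps)
  qed
  then obtain A where A: "\<And>n. Q A n (A n)" by blast
  have "in_S (\<rho> + \<epsilon>) A" using A by (simp add: in_S_def Q_def)
  moreover have "del_op A n (Suc m) = B n (Suc m)" for n m
    using A[of n] unfolding del_op_Suc Q_def rest_def h_def by blast
  ultimately show ?thesis by blast
qed

section \<open>Kernel, cokernel and the direct sum decomposition\<close>

abbreviation (input) "S\<^sub>\<rho> \<equiv> S_space_rho ordp \<gamma> \<kappa> b' \<epsilon>"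
abbreviation (input) "R\<^sub>\<rho> \<equiv> R_space_rho ordp \<gamma> \<kappa> b' \<epsilon>"
abbreviation (input) "S \<equiv> S_space ordp \<gamma> \<kappa> b' \<epsilon>"
abbreviation (input) "R \<equiv> R_space ordp \<gamma> \<kappa> b' \<epsilon>"
abbreviation (input) scale :: "'a \<Rightarrow> 'a fps fps \<Rightarrow> 'a fps fps" where
  "scale c F \<equiv> fps_const (fps_const c) * F"

lemma in_S_mono: "in_S \<rho> A \<Longrightarrow> \<sigma> \<le> \<rho> \<Longrightarrow> in_S \<sigma> A"
  unfolding in_S_def by (meson add_left_mono vge_mono)

lemma S_space_rho_mono: "\<sigma> \<le> \<rho> \<Longrightarrow> S\<^sub>\<rho> \<rho> \<subseteq> S\<^sub>\<rho> \<sigma>"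
  using in_S_mono by (auto simp: S_space_rho_eq)

lemma S_space_rho_0: "0 \<in> S\<^sub>\<rho> \<rho>"
  unfolding S_series_0[symmetric] S_series_in_S_space_rho_iff by (simp add: in_S_def)

lemma S_space_rho_add:
  assumes "F \<in> S\<^sub>\<rho> \<rho>" "G \<in> S\<^sub>\<rho> \<rho>"
  shows "F + G \<in> S\<^sub>\<rho> \<rho>"
proof -
  obtain A B where AB: "F = S_series \<kappa> A" "G = S_series \<kappa> B" "in_S \<rho> A" "in_S \<rho> B"
    using assms by (auto simp: S_space_rho_eq)
  then show ?thesis
    unfolding AB S_series_add S_series_in_S_space_rho_iff by (simp add: in_S_def Omega0_add vge_add)
qed

lemma S_space_add: assumes "F \<in> S" "G \<in> S" shows "F + G \<in> S"
proof -
  obtain \<rho> \<sigma> where "F \<in> S\<^sub>\<rho> \<rho>" "G \<in> S\<^sub>\<rho> \<sigma>" using assms by (auto simp: S_space_def)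
  then have "F \<in> S\<^sub>\<rho> (min \<rho> \<sigma>)" "G \<in> S\<^sub>\<rho> (min \<rho> \<sigma>)"
    using S_space_rho_mono by (meson min.cobounded1 subsetD, meson min.cobounded2 subsetD)
  then show ?thesis using S_space_rho_add by (auto simp: S_space_def)
qed

lemma S_space_scale: assumes "F \<in> S" "c \<in> Omega0 ordp \<gamma>" shows "scale c F \<in> S"
proof -
  obtain \<rho> A where A: "F = S_series \<kappa> A" "in_S \<rho> A" using assms by (auto simp: S_space_def S_space_rho_eq)
  obtain r where r: "vge c r" using vge_bounded_below by blast
  have "in_S (\<rho> + r) (\<lambda>n m. c * A n m)"
    unfolding in_S_def
  proof (intro allI conjI)
    fix n m
    show "c * A n m \<in> Omega0 ordp \<gamma>" using A assms(2) by (auto simp: in_S_def intro: Omega0_mult)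
    have "vge (A n m) (2 * b' * real n + \<epsilon> * real m + \<rho>)" using A by (simp add: in_S_def)
    from vge_mult[OF r this] show "vge (c * A n m) (2 * b' * real n + \<epsilon> * real m + (\<rho> + r))"
      by (simp add: algebra_simps)
  qed
  then show ?thesis unfolding A S_series_scale S_space_def using S_series_in_S_space_rho_iff by blast
qed

lemma scale_minus_1: "scale (- 1) F = - F"
  by (simp flip: fps_const_neg)

lemma S_space_diff: "F \<in> S \<Longrightarrow> G \<in> S \<Longrightarrow> F - G \<in> S"
  using S_space_add[of F "- G"] S_space_scale[of G "- 1"] unfolding scale_minus_1
  by (simp add: Omega0_minus)

lemma R_space_eq: "R = {F \<in> S. \<exists>G. F = fps_const G}"
  by (auto simp: R_space_def R_space_rho_def S_space_def)

lemma R_space_add: "F \<in> R \<Longrightarrow> G \<in> R \<Longrightarrow> F + G \<in> R"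
  unfolding R_space_eq by (auto intro: S_space_add)

lemma R_space_diff: "F \<in> R \<Longrightarrow> G \<in> R \<Longrightarrow> F - G \<in> R"
  unfolding R_space_eq by (auto intro: S_space_diff)

lemma R_space_scale: "F \<in> R \<Longrightarrow> c \<in> Omega0 ordp \<gamma> \<Longrightarrow> scale c F \<in> R"
  unfolding R_space_eq by (auto intro: S_space_scale)

lemma del_kappa_diff: "del_kappa \<kappa> H (F - G) = del_kappa \<kappa> H F - del_kappa \<kappa> H G"
  using del_kappa_add[of "F - G" G] by simp

lemma del_kappa_0: "del_kappa \<kappa> H 0 = 0"
  using del_kappa_diff[of 0 0] by simp

lemma del_kappa_S_space_rho: "F \<in> S\<^sub>\<rho> (\<rho> + \<epsilon>) \<Longrightarrow> del_kappa \<kappa> H F \<in> S\<^sub>\<rho> \<rho>"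
  using in_S_del_op by (auto simp: S_space_rho_eq del_kappa_S_series)

text \<open>\<open>G = 0\<close> gives the vanishing of the kernel, general \<open>G\<close> the
  directness of the sum.\<close>

lemma del_kappa_const_imp_0:
  assumes "F \<in> S" "del_kappa \<kappa> H F = fps_const G"
  shows "F = 0"
proof -
  obtain \<rho> A where A: "F = S_series \<kappa> A" "in_S \<rho> A"
    using assms by (auto simp: S_space_def S_space_rho_eq)
  have "\<forall>n m. del_op A n (Suc m) = 0"
    using assms(2) S_series_const_iff[of "del_op A"] unfolding A del_kappa_S_series by blast
  then show ?thesis using del_op_injective[OF A(2)] by (simp add: A S_series_0)
qed

lemma decomposition:
  assumes "F \<in> S\<^sub>\<rho> \<rho>"
  obtains G E where "G \<in> R\<^sub>\<rho> \<rho>" "E \<in> S\<^sub>\<rho> (\<rho> + \<epsilon>)" "F = G + del_kappa \<kappa> H E"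
proof -
  obtain B where B: "F = S_series \<kappa> B" "in_S \<rho> B" using assms by (auto simp: S_space_rho_eq)
  obtain A where A: "in_S (\<rho> + \<epsilon>) A" "\<forall>n m. del_op A n (Suc m) = B n (Suc m)"
    using del_op_solvable[OF B(2)] by blast
  \<comment> \<open>The remainder vanishes in positive w-degree, so it is constant in w.\<close>
  define C where "C n m = B n m - del_op A n m" for n m
  have "in_S \<rho> C"
    using B(2) in_S_del_op[OF A(1)] by (simp add: in_S_def C_def Omega0_diff vge_diff)
  moreover have "\<exists>G. S_series \<kappa> C = fps_const G"
    unfolding S_series_const_iff using A by (simp add: C_def)
  ultimately have "S_series \<kappa> C \<in> R\<^sub>\<rho> \<rho>"
    by (simp add: R_space_rho_def S_series_in_S_space_rho_iff)
  moreover have "S_series \<kappa> A \<in> S\<^sub>\<rho> (\<rho> + \<epsilon>)" using A by (simp add: S_series_in_S_space_rho_iff)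
  moreover have "F = S_series \<kappa> C + del_kappa \<kappa> H (S_series \<kappa> A)"
    unfolding B del_kappa_S_series S_series_add by (simp add: C_def)
  ultimately show thesis using that by blast
qed

lemma H0_kappa_eq: "H0_kappa \<kappa> H S = {0}"
proof -
  have "F = 0" if "F \<in> S" "del_kappa \<kappa> H F = 0" for F
    using del_kappa_const_imp_0[of F 0] that by simp
  moreover have "0 \<in> S" using S_space_rho_0 by (auto simp: S_space_def)
  ultimately show ?thesis using del_kappa_0 by (auto simp: H0_kappa_def)
qed

lemma direct_sum: "is_direct_sum (S\<^sub>\<rho> 0) (R\<^sub>\<rho> 0) (del_kappa \<kappa> H ` S\<^sub>\<rho> \<epsilon>)"
  unfolding is_direct_sum_def
proof
  show "S\<^sub>\<rho> 0 = R\<^sub>\<rho> 0 + del_kappa \<kappa> H ` S\<^sub>\<rho> \<epsilon>"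
  proof
    show "S\<^sub>\<rho> 0 \<subseteq> R\<^sub>\<rho> 0 + del_kappa \<kappa> H ` S\<^sub>\<rho> \<epsilon>"
    proof
      fix F assume "F \<in> S\<^sub>\<rho> 0"
      then obtain G E where "G \<in> R\<^sub>\<rho> 0" "E \<in> S\<^sub>\<rho> (0 + \<epsilon>)" "F = G + del_kappa \<kappa> H E"
        by (rule decomposition)
      then show "F \<in> R\<^sub>\<rho> 0 + del_kappa \<kappa> H ` S\<^sub>\<rho> \<epsilon>" by (auto simp: set_plus_def)
    qed
    show "R\<^sub>\<rho> 0 + del_kappa \<kappa> H ` S\<^sub>\<rho> \<epsilon> \<subseteq> S\<^sub>\<rho> 0"
      using del_kappa_S_space_rho[of _ 0] by (auto simp: set_plus_def R_space_rho_def intro!: S_space_rho_add)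
  qed
  have "del_kappa \<kappa> H E = 0" if E: "E \<in> S\<^sub>\<rho> \<epsilon>" and R: "del_kappa \<kappa> H E \<in> R\<^sub>\<rho> 0" for E
  proof -
    obtain G where "del_kappa \<kappa> H E = fps_const G" using R by (auto simp: R_space_rho_def)
    moreover have "E \<in> S" using E by (auto simp: S_space_def)
    ultimately have "E = 0" using del_kappa_const_imp_0 by blast
    then show ?thesis by (simp add: del_kappa_0)
  qed
  moreover have "0 \<in> R\<^sub>\<rho> 0" using S_space_rho_0 by (auto simp: R_space_rho_def intro!: exI[of _ 0])
  moreover have "0 \<in> del_kappa \<kappa> H ` S\<^sub>\<rho> \<epsilon>"
    using S_space_rho_0 del_kappa_0 by (metis image_eqI)
  ultimately show "R\<^sub>\<rho> 0 \<inter> del_kappa \<kappa> H ` S\<^sub>\<rho> \<epsilon> = {0}" by auto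
qed

text \<open>Every class contains exactly one element of \<open>R\<close>: existence by
  \<open>decomposition\<close>, uniqueness by \<open>del_kappa_const_imp_0\<close>. The map \<phi>
  selects it and is linear because \<open>R\<close> is closed under the operations.\<close>

lemma H1_iso_exists: "\<exists>\<phi>. is_H1_iso (Omega0 ordp \<gamma>) \<kappa> H S R \<phi>"
proof -
  define N where "N = del_kappa \<kappa> H ` S"
  have N_add: "F + G \<in> N" if "F \<in> N" "G \<in> N" for F G
    using that S_space_add unfolding N_def by (auto simp flip: del_kappa_add)
  have N_diff: "F - G \<in> N" if "F \<in> N" "G \<in> N" for F G
    using that S_space_diff unfolding N_def by (auto simp flip: del_kappa_diff)
  have N_scale: "scale c F \<in> N" if "F \<in> N" "c \<in> Omega0 ordp \<gamma>" for F c
    using that S_space_scale unfolding N_def by (auto simp flip: del_kappa_scale)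
  have N_0: "0 \<in> N" using S_space_rho_0 del_kappa_0 unfolding N_def S_space_def by (metis UN_I UNIV_I image_eqI)
  have RS: "R \<subseteq> S" by (auto simp: R_space_eq)
  have R_N: "F = 0" if F: "F \<in> R" "F \<in> N" for F
  proof -
    obtain E G where "E \<in> S" "F = del_kappa \<kappa> H E" "F = fps_const G"
      using F by (auto simp: R_space_eq N_def)
    then show ?thesis using del_kappa_const_imp_0[of E G] del_kappa_0 by simp
  qed
  have dec: "\<exists>G\<in>R. F - G \<in> N" if F: "F \<in> S" for F
  proof -
    obtain \<rho> where "F \<in> S\<^sub>\<rho> \<rho>" using F by (auto simp: S_space_def)
    then obtain G E where "G \<in> R\<^sub>\<rho> \<rho>" "E \<in> S\<^sub>\<rho> (\<rho> + \<epsilon>)" "F = G + del_kappa \<kappa> H E"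
      by (rule decomposition)
    then show ?thesis unfolding N_def R_space_def S_space_def by (intro bexI[of _ G]) auto
  qed
  let ?cl = "H1_class \<kappa> H S"
  have cl: "?cl F = {G \<in> S. F - G \<in> N}" if "F \<in> S" for F
    using that by (auto simp: H1_class_def H1_rel_def N_def)
  define \<phi> where "\<phi> X = (THE G. G \<in> R \<and> G \<in> X)" for X
  have phi: "\<phi> (?cl F) = G" if "F \<in> S" "G \<in> R" "F - G \<in> N" for F G
    unfolding \<phi>_def
  proof (rule the_equality)
    show "G \<in> R \<and> G \<in> ?cl F" using that RS by (auto simp: cl)
    fix G' assume G': "G' \<in> R \<and> G' \<in> ?cl F"
    then have "F - G' \<in> N" using that by (auto simp: cl)
    from N_diff[OF that(3) this] have "G' - G \<in> N" by simp
    moreover have "G' - G \<in> R" using G' that by (intro R_space_diff) auto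
    ultimately show "G' = G" using R_N[of "G' - G"] by simp
  qed
  have "bij_betw \<phi> (H1_kappa \<kappa> H S) R"
    unfolding bij_betw_def
  proof
    have H1: "\<exists>F\<in>S. X = ?cl F" if "X \<in> H1_kappa \<kappa> H S" for X
      using that by (auto simp: H1_kappa_def H1_class_def quotient_def)
    have cl_H1: "?cl F \<in> H1_kappa \<kappa> H S" if "F \<in> S" for F
      using that by (auto simp: H1_kappa_def H1_class_def quotient_def)
    show "inj_on \<phi> (H1_kappa \<kappa> H S)"
    proof
      fix X Y assume "X \<in> H1_kappa \<kappa> H S" "Y \<in> H1_kappa \<kappa> H S" and eq: "\<phi> X = \<phi> Y"
      then obtain F F' where F: "F \<in> S" "X = ?cl F" "F' \<in> S" "Y = ?cl F'" using H1 by meson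
      obtain G G' where G: "G \<in> R" "F - G \<in> N" "G' \<in> R" "F' - G' \<in> N" using dec F by meson
      then have "G = G'" using phi F eq by metis
      then have "F - F' \<in> N" using N_diff[OF G(2) G(4)] by simp
      then have "F - E \<in> N \<longleftrightarrow> F' - E \<in> N" for E
        using N_add[of "F - F'" "F' - E"] N_diff[of "F - E" "F - F'"] by auto
      then show "X = Y" using F by (simp add: cl)
    qed
    show "\<phi> ` H1_kappa \<kappa> H S = R"
    proof
      show "\<phi> ` H1_kappa \<kappa> H S \<subseteq> R" using H1 dec phi by blast
      show "R \<subseteq> \<phi> ` H1_kappa \<kappa> H S"
      proof
        fix G assume "G \<in> R"
        then have "\<phi> (?cl G) = G" "?cl G \<in> H1_kappa \<kappa> H S"
          using phi[of G G] RS N_0 cl_H1 by auto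
        then show "G \<in> \<phi> ` H1_kappa \<kappa> H S" by (metis image_eqI)
      qed
    qed
  qed
  moreover have "\<phi> (?cl (F + F')) = \<phi> (?cl F) + \<phi> (?cl F')" if F: "F \<in> S" "F' \<in> S" for F F'
  proof -
    obtain G G' where G: "G \<in> R" "F - G \<in> N" "G' \<in> R" "F' - G' \<in> N" using dec F by meson
    have "(F + F') - (G + G') \<in> N" using N_add[OF G(2) G(4)] by (simp add: algebra_simps)
    then show ?thesis using F G phi S_space_add R_space_add by metis
  qed
  moreover have "\<phi> (?cl (scale c F)) = scale c (\<phi> (?cl F))" if F: "c \<in> Omega0 ordp \<gamma>" "F \<in> S" for c F
  proof -
    obtain G where G: "G \<in> R" "F - G \<in> N" using dec F by meson
    have "scale c F - scale c G \<in> N" using N_scale[OF G(2) that(1)] by (simp add: algebra_simps)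
    then show ?thesis using F G phi S_space_scale R_space_scale by metis
  qed
  moreover have "\<phi> (?cl F) = F" if "F \<in> R" for F
    using phi[of F F] that RS N_0 by auto
  ultimately show ?thesis unfolding is_H1_iso_def by blast
qed

end

theorem theorem4p7:
  fixes p :: nat
    and ordp :: "'a::{alg_closed_field, field_char_0} \<Rightarrow> ereal"
    and \<gamma> \<kappa> :: 'a
    and b b' \<epsilon> :: real
    and H :: "nat \<Rightarrow> nat \<Rightarrow> 'a fps"
  assumes "Qp_algebraic_closure p ordp"
    and "p \<ge> 5"
    and "is_splitting_root p ordp \<gamma>"
    and "b \<le> real p / (real p - 1)"
    and "b > 1 / (real p - 1)"
    and "b' \<le> b"
    and "\<epsilon> = b - 1 / (real p - 1)"
    and "is_H_hat p ordp \<gamma> b' b H"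
    and "\<kappa> \<in> Zp ordp"
    and "\<kappa> \<notin> \<nat>"
  shows "H0_kappa \<kappa> H (S_space ordp \<gamma> \<kappa> b' \<epsilon>) = {0} \<and>
    (\<exists>\<phi>. is_H1_iso (Omega0 ordp \<gamma>) \<kappa> H (S_space ordp \<gamma> \<kappa> b' \<epsilon>) (R_space ordp \<gamma> \<kappa> b' \<epsilon>) \<phi>) \<and>
    is_direct_sum (S_space_rho ordp \<gamma> \<kappa> b' \<epsilon> 0) (R_space_rho ordp \<gamma> \<kappa> b' \<epsilon> 0)
      (del_kappa \<kappa> H ` S_space_rho ordp \<gamma> \<kappa> b' \<epsilon> \<epsilon>)"
proof -
  interpret Qp_algebraic_closure p ordp by (rule assms(1))
  interpret symmetric_power_setting p ordp \<gamma> b b' \<epsilon> \<kappa> H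
    by unfold_locales (use assms in auto)
  show ?thesis using H0_kappa_eq H1_iso_exists direct_sum by blast
qed

end
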